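(* Let $M$ be a Riemannian surface in the Minkowski space-time $\mathbb E^4_1$ lying on $\mathcal{LC}^2\times\mathbb R$ for which the function $\alpha$ of the context vanishes at no point. Then $M$ is a pseudo-umbilical surface if and only if every $p\in M$ has a neighborhood in $M$ which is congruent to the surface parametrized by $$\phi(s,t)=\left(-\frac{(s+c_1)(\cos t-3)}{2\sqrt2},\ (s+c_1)\sin t,\ \frac{(s+c_1)(3\cos t-1)}{2\sqrt2},\ s\right)$$ for a constant $c_1$.
   Context: $\mathbb E^{m}_1$ is $\mathbb R^m$ with the metric $\langle\cdot,\cdot\rangle=-dx_1^2+\sum_{i=2}^m dx_i^2$. $\mathcal{LC}^2\times\mathbb R=\{x\in\mathbb E^4_1: -x_1^2+x_2^2+x_3^2=0,\ x_1>0\}$. For a Riemannian surface $M$, $h$, $A$, $\nabla^\perp$ denote the second fundamental form, shape operator and normal connection, and $H=\frac12\mathrm{trace}\,h$. $M$ is pseudo-umbilical if there is a smooth function $f$ with $\langle A_HX,Y\rangle=f\langle X,Y\rangle$ for all tangent $X,Y$. Congruence: two surfaces with position vectors $\phi_1,\phi_2$ are congruent if $\mathbf Q\circ\phi_1=\phi_2$ for a rotation $\mathbf Q$ on the hyperplane $x_4=0$ of $\mathbb E^4_1$ (identified with $\mathbb E^3_1$), i.e. a linear isometry of $\mathbb E^3_1$ acting on the first three coordinates and leaving $x_4$ fixed. The function $\alpha$ of $M$: if $\phi=(\phi_1,\phi_2,\phi_3,\phi_4)$ is the position vector of $M$, then $\theta=(\phi_1,\phi_2,\phi_3,0)$ is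 a light-like normal field along $M$, and with $e_1=(\partial_{x_4})^T$ the tangential part of $\partial_{x_4}|_M$, $\alpha\in C^\infty(M)$ is defined by $\nabla^\perp_{e_1}\theta=\alpha\theta$, equivalently $\partial_{x_4}|_M=e_1-\alpha\theta$. *)

theory Defs
  imports "HOL-Analysis.Analysis"
begin

section \<open>Minkowski space\<close>

definition mink :: "real ^ 'n::{finite, one} \<Rightarrow> real ^ 'n::{finite, one} \<Rightarrow> real" where
  "mink u v = - (u $ 1 * v $ 1) + (\<Sum>i \<in> UNIV - {1}. u $ i * v $ i)"

definition cone_cylinder :: "(real ^ 4) set" where
  "cone_cylinder = {x. - (x $ 1)\<^sup>2 + (x $ 2)\<^sup>2 + (x $ 3)\<^sup>2 = 0 \<and> x $ 1 > 0}"

abbreviation d4 :: "real ^ 4" where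
  "d4 \<equiv> axis 4 1"

text \<open>
  The maps used for congruence: linear isometries of the Minkowski 3-space \<open>x\<^sub>4 = 0\<close>,
  acting on the first three coordinates. The full isometry group is meant, so the time
  orientation may be reversed. This matters: where \<open>\<alpha> < 0\<close> the surface is
  congruent to the half \<open>s + c < 0\<close> of the model, on which \<open>x\<^sub>1 < 0\<close>.
\<close>

definition hyperplane_isometry :: "(real ^ 4 \<Rightarrow> real ^ 4) \<Rightarrow> bool" where
  "hyperplane_isometry Q \<longleftrightarrow>
     (\<exists>R :: real ^ 3 \<Rightarrow> real ^ 3.
        linear R \<and> (\<forall>u v. mink (R u) (R v) = mink u v) \<and>
        (\<forall>x. Q x = (let y = R (vector [x $ 1, x $ 2, x $ 3])
                    in vector [y $ 1, y $ 2, y $ 3, x $ 4])))"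


section \<open>Smooth maps between open subsets of Euclidean spaces\<close>

fun C_k_on :: "nat \<Rightarrow> 'a::euclidean_space set \<Rightarrow> ('a \<Rightarrow> 'b::real_normed_vector) \<Rightarrow> bool" where
  "C_k_on 0 S f \<longleftrightarrow> continuous_on S f"
| "C_k_on (Suc k) S f \<longleftrightarrow>
     (\<forall>x\<in>S. f differentiable (at x)) \<and>
     (\<forall>v. C_k_on k S (\<lambda>x. frechet_derivative f (at x) v))"

text \<open>Derivatives are taken \<open>at x\<close>, so this is only meaningful for open \<open>S\<close>.\<close>

definition smooth_on :: "'a::euclidean_space set \<Rightarrow> ('a \<Rightarrow> 'b::real_normed_vector) \<Rightarrow> bool" where
  "smooth_on S f \<longleftrightarrow> (\<forall>k. C_k_on k S f)"


section \<open>Immersed Riemannian surfaces in the Minkowski space-time\<close>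

text \<open>
  A chart is a pair of a coordinate neighbourhood and a coordinate map to the plane. A surface is
  an abstract 2-manifold together with its position vector, which need not be injective.
\<close>

type_synonym 'a chart = "'a set \<times> ('a \<Rightarrow> real \<times> real)"

record 'a surface =
  topol :: "'a topology"
  atlas :: "'a chart set"
  pos :: "'a \<Rightarrow> real ^ 4"

abbreviation points :: "'a surface \<Rightarrow> 'a set" where
  "points M \<equiv> topspace (topol M)"

definition local_rep :: "'a chart \<Rightarrow> ('a \<Rightarrow> 'b) \<Rightarrow> real \<times> real \<Rightarrow> 'b" where
  "local_rep c F = F \<circ> inv_into (fst c) (snd c)"

definition top_chart :: "'a topology \<Rightarrow> 'a chart \<Rightarrow> bool" where
  "top_chart X c \<longleftrightarrow>
     openin X (fst c) \<and> open (snd c ` fst c) \<and>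
     homeomorphic_map (subtopology X (fst c)) (top_of_set (snd c ` fst c)) (snd c)"

definition smooth_transition :: "'a chart \<Rightarrow> 'a chart \<Rightarrow> bool" where
  "smooth_transition c d \<longleftrightarrow> smooth_on (snd c ` (fst c \<inter> fst d)) (local_rep c (snd d))"

text \<open>The charts of the maximal atlas determined by the given one.\<close>

definition smooth_chart :: "'a surface \<Rightarrow> 'a chart \<Rightarrow> bool" where
  "smooth_chart M c \<longleftrightarrow>
     top_chart (topol M) c \<and> (\<forall>d\<in>atlas M. smooth_transition c d \<and> smooth_transition d c)"

definition smooth_map :: "'a surface \<Rightarrow> 'a set \<Rightarrow> ('a \<Rightarrow> 'b::real_normed_vector) \<Rightarrow> bool" where
  "smooth_map M W F \<longleftrightarrow> (\<forall>c\<in>atlas M. smooth_on (snd c ` (fst c \<inter> W)) (local_rep c F))"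

text \<open>The last condition says that the metric induced by the position vector is positive
  definite; in particular the position vector is an immersion.\<close>

definition riemannian_surface :: "'a surface \<Rightarrow> bool" where
  "riemannian_surface M \<longleftrightarrow>
     Hausdorff_space (topol M) \<and> second_countable (topol M) \<and>
     (\<forall>c\<in>atlas M. smooth_chart M c) \<and> (\<Union>c\<in>atlas M. fst c) = points M \<and>
     smooth_map M (points M) (pos M) \<and>
     (\<forall>c\<in>atlas M. \<forall>u \<in> snd c ` fst c. \<forall>a. a \<noteq> 0 \<longrightarrow>
        (let v = frechet_derivative (local_rep c (pos M)) (at u) a in mink v v > 0))"

text \<open>Tangent vectors are identified with their images in \<open>\<real>\<^sup>4\<close> under the
  differential of the position vector.\<close>

definition tangent_space :: "'a surface \<Rightarrow> 'a \<Rightarrow> (real ^ 4) set" where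
  "tangent_space M p =
     (\<Union>c \<in> {c \<in> atlas M. p \<in> fst c}. range (frechet_derivative (local_rep c (pos M)) (at (snd c p))))"

definition tan_part :: "'a surface \<Rightarrow> 'a \<Rightarrow> real ^ 4 \<Rightarrow> real ^ 4" where
  "tan_part M p v = (THE w. w \<in> tangent_space M p \<and> (\<forall>u \<in> tangent_space M p. mink (v - w) u = 0))"

definition nor_part :: "'a surface \<Rightarrow> 'a \<Rightarrow> real ^ 4 \<Rightarrow> real ^ 4" where
  "nor_part M p v = v - tan_part M p v"

text \<open>The flat connection of the ambient space, applied to a vector field \<open>F\<close> along the
  surface: the derivative of \<open>F\<close> at \<open>p\<close> in the direction of the tangent vector
  \<open>v\<close>. For \<open>F\<close> smooth near \<open>p\<close> all charts give the same value.\<close>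

definition flat_deriv :: "'a surface \<Rightarrow> 'a \<Rightarrow> real ^ 4 \<Rightarrow> ('a \<Rightarrow> real ^ 4) \<Rightarrow> real ^ 4" where
  "flat_deriv M p v F =
     (THE w. \<exists>c \<in> atlas M. p \<in> fst c \<and>
        (\<exists>a. v = frechet_derivative (local_rep c (pos M)) (at (snd c p)) a \<and>
             w = frechet_derivative (local_rep c F) (at (snd c p)) a))"

definition tangent_field :: "'a surface \<Rightarrow> 'a set \<Rightarrow> ('a \<Rightarrow> real ^ 4) \<Rightarrow> bool" where
  "tangent_field M W Y \<longleftrightarrow> smooth_map M W Y \<and> (\<forall>q\<in>W. Y q \<in> tangent_space M q)"

text \<open>Gauss formula; the value does not depend on the local extension \<open>Y\<close> of
  \<open>w\<close>.\<close>

definition second_ff :: "'a surface \<Rightarrow> 'a \<Rightarrow> real ^ 4 \<Rightarrow> real ^ 4 \<Rightarrow> real ^ 4" where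
  "second_ff M p v w =
     (THE n. \<exists>W Y. openin (topol M) W \<and> p \<in> W \<and> tangent_field M W Y \<and> Y p = w \<and>
        n = nor_part M p (flat_deriv M p v Y))"

text \<open>Weingarten formula, for a normal vector field \<open>\<xi>\<close>.\<close>

definition shape_op :: "'a surface \<Rightarrow> ('a \<Rightarrow> real ^ 4) \<Rightarrow> 'a \<Rightarrow> real ^ 4 \<Rightarrow> real ^ 4" where
  "shape_op M \<xi> p v = - tan_part M p (flat_deriv M p v \<xi>)"

definition normal_conn :: "'a surface \<Rightarrow> 'a \<Rightarrow> real ^ 4 \<Rightarrow> ('a \<Rightarrow> real ^ 4) \<Rightarrow> real ^ 4" where
  "normal_conn M p v \<xi> = nor_part M p (flat_deriv M p v \<xi>)"

text \<open>Half the trace of the second fundamental form, computed in any orthonormal basis.\<close>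

definition mean_curv :: "'a surface \<Rightarrow> 'a \<Rightarrow> real ^ 4" where
  "mean_curv M p =
     (THE n. \<exists>e\<^sub>1 \<in> tangent_space M p. \<exists>e\<^sub>2 \<in> tangent_space M p.
        mink e\<^sub>1 e\<^sub>1 = 1 \<and> mink e\<^sub>2 e\<^sub>2 = 1 \<and> mink e\<^sub>1 e\<^sub>2 = 0 \<and>
        n = (1 / 2) *\<^sub>R (second_ff M p e\<^sub>1 e\<^sub>1 + second_ff M p e\<^sub>2 e\<^sub>2))"

definition pseudo_umbilical :: "'a surface \<Rightarrow> bool" where
  "pseudo_umbilical M \<longleftrightarrow>
     (\<exists>f :: 'a \<Rightarrow> real. smooth_map M (points M) f \<and>
        (\<forall>p \<in> points M. \<forall>v \<in> tangent_space M p. \<forall>w \<in> tangent_space M p.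
           mink (shape_op M (mean_curv M) p v) w = f p * mink v w))"


section \<open>Surfaces on the cylinder over the light cone\<close>

definition theta :: "'a surface \<Rightarrow> 'a \<Rightarrow> real ^ 4" where
  "theta M p = vector [pos M p $ 1, pos M p $ 2, pos M p $ 3, 0]"

definition alpha :: "'a surface \<Rightarrow> 'a \<Rightarrow> real" where
  "alpha M p = (THE a. normal_conn M p (tan_part M p d4) (theta M) = a *\<^sub>R theta M p)"

definition model :: "real \<Rightarrow> real \<times> real \<Rightarrow> real ^ 4" where
  "model c = (\<lambda>(s, t). vector
     [- ((s + c) * (cos t - 3) / (2 * sqrt 2)),
      (s + c) * sin t,
      (s + c) * (3 * cos t - 1) / (2 * sqrt 2),
      s])"

text \<open>An open part \<open>U\<close> of the surface is congruent to a parametrized surface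
  \<open>\<psi>\<close> if, in suitable smooth coordinates \<open>(s, t)\<close> on all of \<open>U\<close>,
  its position vector is \<open>Q \<circ> \<psi>\<close>. As \<open>U\<close> is only a neighbourhood of a
  point, the coordinates range over an open part of the domain of \<open>\<psi>\<close>.\<close>

definition congruent_to :: "'a surface \<Rightarrow> 'a set \<Rightarrow> (real \<times> real \<Rightarrow> real ^ 4) \<Rightarrow> bool" where
  "congruent_to M U \<psi> \<longleftrightarrow>
     (\<exists>Q \<sigma>. hyperplane_isometry Q \<and> smooth_chart M (U, \<sigma>) \<and>
        (\<forall>p\<in>U. pos M p = Q (\<psi> (\<sigma> p))))"

end

theory Submission
  imports Defs
begin

text \<open>
  Where the metric is positive definite, a surface on the cylinder over the light cone is locally
  \<open>\<phi>(z, v) = q(z, v) L(v) + z \<partial>\<^sub>4\<close>, with \<open>L\<close> a fixed curve of null vectors in the hyperplane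
  \<open>x\<^sub>4 = 0\<close> and \<open>\<langle>L', L'\<rangle> = 1\<close>. The metric is \<open>dz\<^sup>2 + q\<^sup>2 dv\<^sup>2\<close>, the field \<open>e\<^sub>1\<close> is \<open>\<partial>\<^sub>z\<close>, and
  \<open>\<alpha> = q\<^sub>z / q\<close>. With \<open>\<rho> = q\<^sub>v / q\<close>, computing \<open>H\<close> and \<open>\<langle>A\<^sub>H X, Y\<rangle> = \<langle>H, D\<^sub>X Y\<rangle>\<close> in the
  frame of unit coordinate fields shows (lemma \<open>pseudo_umbilical_at_iff\<close>) that pseudo-umbilicity is
  the system
  \<open>\<rho>\<^sub>z = 0\<close>, \<open>(q\<^sub>z)\<^sub>v = \<rho> q\<^sub>z\<close>, \<open>2 \<rho>\<^sub>v = \<rho>\<^sup>2 + \<langle>L'', L''\<rangle> - q\<^sub>z\<^sup>2\<close>,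
  with \<open>f = - q\<^sub>z\<^sub>z / (2 q)\<close>.

  For the forward direction \<open>L\<close> is taken to be a parabola, so that \<open>L''\<close> is null. The first and the
  third equation make \<open>q\<^sub>z\<^sup>2\<close> independent of \<open>z\<close>; since \<open>\<alpha> \<noteq> 0\<close> means \<open>q\<^sub>z \<noteq> 0\<close>, this gives
  \<open>q\<^sub>z\<^sub>z = 0\<close>. Then \<open>1 / q\<^sub>z\<close> is a function of \<open>v\<close> with vanishing third derivative, that is, of the
  form \<open>\<langle>W, L(v)\<rangle>\<close> for a constant vector \<open>W\<close>, and the system also yields \<open>\<langle>W, W\<rangle> = -1\<close> and
  \<open>q / q\<^sub>z = z + c\<close> (lemma \<open>umbilical_equations_integrate\<close>). Hence the surface lies in the hyperplane
  \<open>\<langle>W, x\<rangle> = x\<^sub>4 + c\<close> (lemma \<open>pseudo_umbilical_hyperplane\<close>). The model surface is the section by such a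
  hyperplane of the cylinder over both nappes of the cone, and the isometries of Minkowski 3-space
  act transitively on pairs of a unit timelike vector \<open>W\<close> and a null vector \<open>y\<close> with \<open>\<langle>W, y\<rangle> = 1\<close>
  (lemma \<open>congruent_to_model_if_hyperplane\<close>).

  Conversely, the model has the form above with \<open>q = s + c\<close> and \<open>L\<close> a circle with
  \<open>\<langle>L'', L''\<rangle> = 1\<close>; there \<open>\<rho> = 0\<close> and \<open>q\<^sub>z = 1\<close>, and the system holds with \<open>f = 0\<close>
  (lemma \<open>pseudo_umbilical_if_model\<close>). As this \<open>f\<close> is the same for all local models, it is a smooth
  function on the whole surface.
\<close>

section \<open>Calculus of smooth maps\<close>

text \<open>Since derivatives are taken at points of an open set, a map that agrees with a \<open>C\<^sup>k\<close> map on
  an open set is itself \<open>C\<^sup>k\<close> there. This is what allows a derivative found by the calculus rules to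
  replace the Frechet derivative chosen in the definition.\<close>

lemma C_k_on_cong:
  assumes "open S" "\<And>x. x \<in> S \<Longrightarrow> f x = g x" "C_k_on k S f"
  shows "C_k_on k S g"
  using assms(2,3)
proof (induction k arbitrary: f g)
  case 0
  then show ?case by (simp cong: continuous_on_cong)
next
  case (Suc k)
  have diff: "f differentiable (at x)" if "x \<in> S" for x
    using Suc.prems that by simp
  have eq: "(g has_derivative frechet_derivative f (at x)) (at x)" if "x \<in> S" for x
  proof -
    have "(f has_derivative frechet_derivative f (at x)) (at x)"
      using diff[OF that] frechet_derivative_works by blast
    from has_derivative_transform_within_open[OF this \<open>open S\<close> that Suc.prems(1)]
    show ?thesis .
  qed
  have "frechet_derivative f (at x) = frechet_derivative g (at x)" if "x \<in> S" for x
    using frechet_derivative_at[OF eq[OF that]] .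
  then have "C_k_on k S (\<lambda>x. frechet_derivative g (at x) v)" for v
    using Suc.IH[of "\<lambda>x. frechet_derivative f (at x) v" "\<lambda>x. frechet_derivative g (at x) v"] Suc.prems(2)
    by simp
  then show ?case
    using eq unfolding C_k_on.simps differentiable_def by blast
qed

lemma C_k_on_SucI:
  assumes "open S" "\<And>x. x \<in> S \<Longrightarrow> (f has_derivative f' x) (at x)"
    and "\<And>v. C_k_on k S (\<lambda>x. f' x v)"
  shows "C_k_on (Suc k) S f"
proof -
  have "f' x v = frechet_derivative f (at x) v" if "x \<in> S" for x v
    using frechet_derivative_at[OF assms(2)[OF that]] by simp
  from C_k_on_cong[OF assms(1) this assms(3)]
  have "C_k_on k S (\<lambda>x. frechet_derivative f (at x) v)" for v .
  then show ?thesis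
    using assms(2) unfolding C_k_on.simps differentiable_def by blast
qed

lemma C_k_on_lower: "C_k_on (Suc k) S f \<Longrightarrow> C_k_on k S f"
proof (induction k arbitrary: f)
  case 0
  then show ?case
    by (simp add: continuous_at_imp_continuous_on differentiable_imp_continuous_within)
next
  case (Suc k)
  show ?case
    using Suc.IH Suc.prems unfolding C_k_on.simps(2) by blast
qed

lemma C_k_on_subset: "C_k_on k S f \<Longrightarrow> T \<subseteq> S \<Longrightarrow> C_k_on k T f"
proof (induction k arbitrary: f)
  case 0
  then show ?case using continuous_on_subset[of S f T] by simp
next
  case (Suc k)
  then show ?case unfolding C_k_on.simps by blast
qed

lemma C_k_on_locally:
  assumes "\<And>x. x \<in> S \<Longrightarrow> \<exists>T. open T \<and> x \<in> T \<and> C_k_on k T f"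
  shows "C_k_on k S f"
  using assms
proof (induction k arbitrary: f)
  case 0
  have "isCont f x" if "x \<in> S" for x
    using "0.prems"[OF that] unfolding C_k_on.simps by (meson continuous_on_eq_continuous_at)
  then show ?case by (simp add: continuous_at_imp_continuous_on)
next
  case (Suc k)
  show ?case
    unfolding C_k_on.simps(2)
  proof (intro conjI ballI allI)
    fix x assume "x \<in> S"
    then show "f differentiable at x"
      using Suc.prems[of x] unfolding C_k_on.simps(2) by blast
  next
    fix v
    show "C_k_on k S (\<lambda>x. frechet_derivative f (at x) v)"
    proof (rule Suc.IH)
      fix x assume "x \<in> S"
      then obtain T where "open T" "x \<in> T" "C_k_on (Suc k) T f" using Suc.prems by blast
      then show "\<exists>T. open T \<and> x \<in> T \<and> C_k_on k T (\<lambda>x. frechet_derivative f (at x) v)"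
        unfolding C_k_on.simps(2) by blast
    qed
  qed
qed

lemma C_k_on_const: "open S \<Longrightarrow> C_k_on k S (\<lambda>x. c)"
proof (induction k arbitrary: c)
  case (Suc k)
  show ?case
    by (rule C_k_on_SucI[OF \<open>open S\<close> has_derivative_const Suc.IH[OF \<open>open S\<close>]])
qed simp

lemma C_k_on_has_derivative:
  assumes "C_k_on (Suc k) S f" "x \<in> S"
  shows "(f has_derivative frechet_derivative f (at x)) (at x)"
  using assms frechet_derivative_works[of f "at x"] unfolding C_k_on.simps(2) by blast

lemma C_k_on_bounded_linear:
  assumes h: "bounded_linear h" and "open S" "C_k_on k S f"
  shows "C_k_on k S (\<lambda>x. h (f x))"
  using assms(3)
proof (induction k arbitrary: f)
  case 0
  then show ?case using bounded_linear.continuous_on[OF h, of S f] by simp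
next
  case (Suc k)
  show ?case
  proof (rule C_k_on_SucI[OF \<open>open S\<close>])
    show "((\<lambda>x. h (f x)) has_derivative (\<lambda>v. h (frechet_derivative f (at x) v))) (at x)" if "x \<in> S" for x
      by (rule bounded_linear.has_derivative[OF h C_k_on_has_derivative[OF Suc.prems that]])
    show "C_k_on k S (\<lambda>x. h (frechet_derivative f (at x) v))" for v
      by (rule Suc.IH) (use Suc.prems in simp)
  qed
qed

lemma C_k_on_add:
  assumes "open S" "C_k_on k S f" "C_k_on k S g"
  shows "C_k_on k S (\<lambda>x. f x + g x)"
  using assms(2,3)
proof (induction k arbitrary: f g)
  case 0
  then show ?case using continuous_on_add[of S f g] by simp
next
  case (Suc k)
  show ?case
  proof (rule C_k_on_SucI[OF \<open>open S\<close>])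
    show "((\<lambda>x. f x + g x) has_derivative
        (\<lambda>v. frechet_derivative f (at x) v + frechet_derivative g (at x) v)) (at x)" if "x \<in> S" for x
      by (rule has_derivative_add[OF Suc.prems[THEN C_k_on_has_derivative, OF that]])
    show "C_k_on k S (\<lambda>x. frechet_derivative f (at x) v + frechet_derivative g (at x) v)" for v
      by (rule Suc.IH) (use Suc.prems in simp_all)
  qed
qed

lemma C_k_on_sum:
  assumes "open S" "\<And>i. i \<in> I \<Longrightarrow> C_k_on k S (f i)"
  shows "C_k_on k S (\<lambda>x. \<Sum>i\<in>I. f i x)"
  using assms(2)
proof (induction I rule: infinite_finite_induct)
  case (insert i I)
  then have "C_k_on k S (\<lambda>x. f i x + (\<Sum>j\<in>I. f j x))"
    by (intro C_k_on_add[OF assms(1)]) simp_all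
  with insert.hyps show ?case by (simp cong: if_cong)
qed (simp_all add: C_k_on_const[OF assms(1)])

text \<open>The product rule expresses the derivative through products of \<open>f\<close>, \<open>g\<close> and their
  derivatives, all of which are one order less smooth.\<close>

lemma C_k_on_bilinear:
  assumes h: "bounded_bilinear h" and "open S" "C_k_on k S f" "C_k_on k S g"
  shows "C_k_on k S (\<lambda>x. h (f x) (g x))"
  using assms(3,4)
proof (induction k arbitrary: f g)
  case 0
  then show ?case using bounded_bilinear.continuous_on[OF h, of S f g] by simp
next
  case (Suc k)
  show ?case
  proof (rule C_k_on_SucI[OF \<open>open S\<close>])
    show "((\<lambda>x. h (f x) (g x)) has_derivative
        (\<lambda>v. h (f x) (frechet_derivative g (at x) v) + h (frechet_derivative f (at x) v) (g x))) (at x)"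
      if "x \<in> S" for x
      by (rule bounded_bilinear.FDERIV[OF h Suc.prems[THEN C_k_on_has_derivative, OF that]])
    show "C_k_on k S (\<lambda>x. h (f x) (frechet_derivative g (at x) v) + h (frechet_derivative f (at x) v) (g x))"
      for v
    proof (rule C_k_on_add[OF \<open>open S\<close>])
      show "C_k_on k S (\<lambda>x. h (f x) (frechet_derivative g (at x) v))"
        by (rule Suc.IH[OF C_k_on_lower[OF Suc.prems(1)]]) (use Suc.prems in simp)
      show "C_k_on k S (\<lambda>x. h (frechet_derivative f (at x) v) (g x))"
        by (rule Suc.IH[OF _ C_k_on_lower[OF Suc.prems(2)]]) (use Suc.prems in simp)
    qed
  qed
qed

text \<open>The chain rule is used in coordinates, \<open>D(g \<circ> f) v = \<Sum>\<^sub>b (Df v \<bullet> b) Dg b\<close>: this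
  writes the derivative as a bilinear expression in maps that are one order less smooth, so that
  induction on the order applies.\<close>

lemma C_k_on_compose:
  fixes f :: "'a::euclidean_space \<Rightarrow> 'b::euclidean_space" and g :: "'b \<Rightarrow> 'c::real_normed_vector"
  assumes "open S" "open T" "f ` S \<subseteq> T" "C_k_on k S f" "C_k_on k T g"
  shows "C_k_on k S (\<lambda>x. g (f x))"
  using assms(4,5)
proof (induction k arbitrary: g)
  case 0
  then show ?case using assms(3) continuous_on_compose2[of T g S f] by simp
next
  case (Suc k)
  show ?case
  proof (rule C_k_on_SucI[OF \<open>open S\<close>])
    let ?D = "\<lambda>x v. \<Sum>b\<in>Basis. (frechet_derivative f (at x) v \<bullet> b) *\<^sub>R frechet_derivative g (at (f x)) b"
    show "((\<lambda>x. g (f x)) has_derivative ?D x) (at x)" if "x \<in> S" for x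
    proof -
      have g: "(g has_derivative frechet_derivative g (at (f x))) (at (f x))"
        using C_k_on_has_derivative[OF Suc.prems(2), of "f x"] that assms(3) by blast
      then interpret dg: linear "frechet_derivative g (at (f x))"
        by (rule has_derivative_linear)
      have "?D x v = frechet_derivative g (at (f x)) (\<Sum>b\<in>Basis. (frechet_derivative f (at x) v \<bullet> b) *\<^sub>R b)" for v
        by (simp add: dg.sum dg.scale)
      then have "?D x = (\<lambda>v. frechet_derivative g (at (f x)) (frechet_derivative f (at x) v))"
        by (simp add: euclidean_representation)
      then show ?thesis
        using has_derivative_compose[OF C_k_on_has_derivative[OF Suc.prems(1) that] g] by simp
    qed
    have f: "C_k_on k S (\<lambda>x. frechet_derivative f (at x) v)" for v using Suc.prems by simp
    have "C_k_on k S (\<lambda>x. frechet_derivative f (at x) v \<bullet> b)" for v b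
      by (rule C_k_on_bounded_linear[OF bounded_linear_inner_left \<open>open S\<close> f])
    moreover have "C_k_on k S (\<lambda>x. frechet_derivative g (at (f x)) b)" for b
      by (rule Suc.IH[OF C_k_on_lower[OF Suc.prems(1)]]) (use Suc.prems(2) in simp)
    ultimately show "C_k_on k S (\<lambda>x. ?D x v)" for v
      by (intro C_k_on_sum[OF \<open>open S\<close>] C_k_on_bilinear[OF bounded_bilinear_scaleR \<open>open S\<close>])
  qed
qed

lemma smooth_on_cong:
  "open S \<Longrightarrow> (\<And>x. x \<in> S \<Longrightarrow> f x = g x) \<Longrightarrow> smooth_on S f \<Longrightarrow> smooth_on S g"
  unfolding smooth_on_def using C_k_on_cong[of S f g] by simp

lemma smooth_on_subset: "smooth_on S f \<Longrightarrow> T \<subseteq> S \<Longrightarrow> smooth_on T f"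
  unfolding smooth_on_def by (blast intro: C_k_on_subset)

lemma smooth_on_locally:
  "(\<And>x. x \<in> S \<Longrightarrow> \<exists>T. open T \<and> x \<in> T \<and> smooth_on T f) \<Longrightarrow> smooth_on S f"
  unfolding smooth_on_def by (intro allI C_k_on_locally) fast

lemma smooth_on_has_derivative:
  "smooth_on S f \<Longrightarrow> x \<in> S \<Longrightarrow> (f has_derivative frechet_derivative f (at x)) (at x)"
  unfolding smooth_on_def using C_k_on_has_derivative[of 0 S f x] by simp

lemma smooth_on_frechet_derivative:
  "smooth_on S f \<Longrightarrow> smooth_on S (\<lambda>x. frechet_derivative f (at x) v)"
  unfolding smooth_on_def using C_k_on.simps(2)[of _ S f] by simp

lemma smooth_on_imp_continuous_on: "smooth_on S f \<Longrightarrow> continuous_on S f"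
  unfolding smooth_on_def using C_k_on.simps(1)[of S f] by simp

lemma smooth_on_const: "open S \<Longrightarrow> smooth_on S (\<lambda>x. c)"
  unfolding smooth_on_def using C_k_on_const[of S _ c] by simp

lemma smooth_on_add:
  "open S \<Longrightarrow> smooth_on S f \<Longrightarrow> smooth_on S g \<Longrightarrow> smooth_on S (\<lambda>x. f x + g x)"
  unfolding smooth_on_def using C_k_on_add[of S _ f g] by simp

lemma smooth_on_bounded_linear_comp:
  "bounded_linear h \<Longrightarrow> open S \<Longrightarrow> smooth_on S f \<Longrightarrow> smooth_on S (\<lambda>x. h (f x))"
  unfolding smooth_on_def using C_k_on_bounded_linear[of h S _ f] by simp

lemma smooth_on_bilinear:
  "bounded_bilinear h \<Longrightarrow> open S \<Longrightarrow> smooth_on S f \<Longrightarrow> smooth_on S g \<Longrightarrow> smooth_on S (\<lambda>x. h (f x) (g x))"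
  unfolding smooth_on_def using C_k_on_bilinear[of h S _ f g] by simp

lemma smooth_on_compose:
  fixes f :: "'a::euclidean_space \<Rightarrow> 'b::euclidean_space" and g :: "'b \<Rightarrow> 'c::real_normed_vector"
  shows "smooth_on T g \<Longrightarrow> smooth_on S f \<Longrightarrow> open S \<Longrightarrow> open T \<Longrightarrow> f ` S \<subseteq> T \<Longrightarrow> smooth_on S (\<lambda>x. g (f x))"
  unfolding smooth_on_def using C_k_on_compose[of S T f _ g] by simp

lemma smooth_on_bounded_linear:
  assumes "bounded_linear h" "open S"
  shows "smooth_on S h"
  unfolding smooth_on_def
proof
  fix k show "C_k_on k S h"
  proof (cases k)
    case 0
    then show ?thesis using assms by (simp add: linear_continuous_on)
  next
    case (Suc m)
    show ?thesis unfolding Suc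
      by (rule C_k_on_SucI[OF assms(2) bounded_linear_imp_has_derivative[OF assms(1)]])
        (rule C_k_on_const[OF assms(2)])
  qed
qed

lemmas smooth_on_scaleR = smooth_on_bilinear[OF bounded_bilinear_scaleR]
lemmas smooth_on_mult = smooth_on_bilinear[OF bounded_bilinear_mult]
lemmas smooth_on_ident = smooth_on_bounded_linear[OF bounded_linear_ident]
lemmas smooth_on_fst = smooth_on_bounded_linear_comp[OF bounded_linear_fst]
lemmas smooth_on_snd = smooth_on_bounded_linear_comp[OF bounded_linear_snd]
lemmas smooth_on_vec_nth = smooth_on_bounded_linear_comp[OF bounded_linear_vec_nth]
lemmas smooth_on_minus = smooth_on_bounded_linear_comp[OF bounded_linear_minus[OF bounded_linear_ident]]

lemma smooth_on_diff:
  fixes f g :: "_ \<Rightarrow> 'b::real_normed_vector"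
  shows "open S \<Longrightarrow> smooth_on S f \<Longrightarrow> smooth_on S g \<Longrightarrow> smooth_on S (\<lambda>x. f x - g x)"
  using smooth_on_add[of S f "\<lambda>x. - g x"] smooth_on_minus[of S g] by simp

lemma smooth_on_Pair:
  assumes "open S" "smooth_on S f" "smooth_on S g"
  shows "smooth_on S (\<lambda>x. (f x, g x))"
proof -
  have "bounded_linear (\<lambda>a::'b. (a, 0::'c))" "bounded_linear (\<lambda>b::'c. (0::'b, b))"
    by (intro bounded_linear_Pair bounded_linear_ident bounded_linear_zero)+
  then have "smooth_on S (\<lambda>x. (f x, 0::'c) + (0::'b, g x))"
    using assms by (intro smooth_on_add) (auto intro: smooth_on_bounded_linear_comp)
  then show ?thesis by simp
qed

lemma smooth_on_inverse:
  fixes f :: "'a::euclidean_space \<Rightarrow> real"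
  assumes "open S" "smooth_on S f" "\<And>x. x \<in> S \<Longrightarrow> f x \<noteq> 0"
  shows "smooth_on S (\<lambda>x. inverse (f x))"
proof -
  have o: "open (- {0::real})" by auto
  have "C_k_on k (- {0}) (inverse :: real \<Rightarrow> real)" for k
  proof (induction k)
    case 0
    show ?case by (auto intro!: continuous_intros)
  next
    case (Suc k)
    show ?case
    proof (rule C_k_on_SucI[OF o])
      show "(inverse has_derivative (\<lambda>v. - (inverse x * v * inverse x))) (at x)"
        if "x \<in> - {0}" for x :: real
        using that has_derivative_inverse'[of x] by simp
      show "C_k_on k (- {0}) (\<lambda>x. - (inverse x * v * inverse x))" for v :: real
        by (intro C_k_on_bounded_linear[OF bounded_linear_minus[OF bounded_linear_ident]] o
            C_k_on_bilinear[OF bounded_bilinear_mult] Suc.IH C_k_on_const)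
    qed
  qed
  then have "smooth_on (- {0}) (inverse :: real \<Rightarrow> real)" unfolding smooth_on_def ..
  from smooth_on_compose[OF this assms(2) assms(1) o] assms(3) show ?thesis by force
qed

lemma smooth_on_divide:
  fixes f g :: "'a::euclidean_space \<Rightarrow> real"
  assumes "open S" "smooth_on S f" "smooth_on S g" "\<And>x. x \<in> S \<Longrightarrow> g x \<noteq> 0"
  shows "smooth_on S (\<lambda>x. f x / g x)"
  unfolding divide_inverse by (intro smooth_on_mult smooth_on_inverse assms)

lemma smooth_on_arctan: "smooth_on UNIV (arctan :: real \<Rightarrow> real)"
  unfolding smooth_on_def
proof
  fix k :: nat
  show "C_k_on k UNIV (arctan :: real \<Rightarrow> real)"
  proof (cases k)
    case 0
    show ?thesis unfolding 0 by (auto intro!: continuous_intros)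
  next
    case (Suc m)
    show ?thesis unfolding Suc
    proof (rule C_k_on_SucI)
      show "(arctan has_derivative (\<lambda>v. inverse (1 + x * x) * v)) (at x)" for x :: real
        using DERIV_arctan[of x] unfolding has_field_derivative_def
        by (simp add: power2_eq_square)
      have "1 + x * x \<noteq> 0" for x :: real by (smt (verit) zero_le_square)
      then have "smooth_on UNIV (\<lambda>x. inverse (1 + x * x) * v)" for v :: real
        by (intro smooth_on_mult smooth_on_inverse smooth_on_add smooth_on_const smooth_on_ident) auto
      then show "C_k_on m UNIV (\<lambda>x. inverse (1 + x * x) * v)" for v :: real
        unfolding smooth_on_def by blast
    qed simp
  qed
qed

lemma smooth_on_sin: "smooth_on UNIV (sin :: real \<Rightarrow> real)"
  and smooth_on_cos: "smooth_on UNIV (cos :: real \<Rightarrow> real)"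
proof -
  have "C_k_on k UNIV (sin :: real \<Rightarrow> real) \<and> C_k_on k UNIV (cos :: real \<Rightarrow> real)" for k
  proof (induction k)
    case 0
    show ?case by (auto intro!: continuous_intros)
  next
    case (Suc k)
    have "C_k_on k UNIV (\<lambda>x. cos x * v)" "C_k_on k UNIV (\<lambda>x. - sin x * v)" for v :: real
      using Suc by (auto intro!: C_k_on_bilinear[OF bounded_bilinear_mult] C_k_on_const
          C_k_on_bounded_linear[OF bounded_linear_minus[OF bounded_linear_ident]])
    then show ?case
      using C_k_on_SucI[OF open_UNIV, of sin "\<lambda>x v. cos x * v" k]
        C_k_on_SucI[OF open_UNIV, of cos "\<lambda>x v. - sin x * v" k]
        DERIV_sin DERIV_cos unfolding has_field_derivative_def by metis
  qed
  then show "smooth_on UNIV (sin :: real \<Rightarrow> real)" "smooth_on UNIV (cos :: real \<Rightarrow> real)"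
    unfolding smooth_on_def by blast+
qed

lemma linear_plane:
  fixes h :: "real \<times> real \<Rightarrow> 'b::real_vector"
  assumes "linear h"
  shows "h a = fst a *\<^sub>R h (1, 0) + snd a *\<^sub>R h (0, 1)"
proof -
  have "h a = h (fst a *\<^sub>R (1, 0) + snd a *\<^sub>R (0, 1))" by simp
  then show ?thesis by (simp only: linear_add[OF assms] linear_scale[OF assms])
qed

text \<open>By Cramer's rule the derivative of the inverse map is a rational expression in the partial
  derivatives of \<open>f\<close>, composed with the inverse map itself; each such expression gains one order
  of smoothness.\<close>

lemma smooth_on_inverse_map:
  fixes f g :: "real \<times> real \<Rightarrow> real \<times> real"
  assumes "open S" "open T" "smooth_on S f" "g ` T \<subseteq> S"
    and fg: "\<And>y. y \<in> T \<Longrightarrow> f (g y) = y"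
    and dg: "\<And>y. y \<in> T \<Longrightarrow> g differentiable (at y)"
  shows "smooth_on T g"
proof -
  define a b where "a x = frechet_derivative f (at x) (1, 0)"
    and "b x = frechet_derivative f (at x) (0, 1)" for x
  define det where "det x = fst (a x) * snd (b x) - snd (a x) * fst (b x)" for x
  define G where "G x v = ((fst v * snd (b x) - snd v * fst (b x)) / det x,
      (fst (a x) * snd v - snd (a x) * fst v) / det x)" for x v
  have sm: "smooth_on S a" "smooth_on S b"
    unfolding a_def b_def by (intro smooth_on_frechet_derivative assms)+
  have key: "det (g y) \<noteq> 0 \<and> (g has_derivative G (g y)) (at y)" if y: "y \<in> T" for y
  proof -
    let ?f = "frechet_derivative f (at (g y))" and ?g = "frechet_derivative g (at y)"
    have f: "(f has_derivative ?f) (at (g y))"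
      using assms y by (intro smooth_on_has_derivative) auto
    have g: "(g has_derivative ?g) (at y)" using dg[OF y] frechet_derivative_works by blast
    have "((\<lambda>y. f (g y)) has_derivative (\<lambda>v. ?f (?g v))) (at y)"
      by (rule has_derivative_compose[OF g f])
    moreover have "((\<lambda>y. f (g y)) has_derivative (\<lambda>v. v)) (at y)"
      by (rule has_derivative_transform_within_open[OF has_derivative_ident \<open>open T\<close> y]) (simp add: fg)
    ultimately have "?f (?g v) = v" for v by (metis has_derivative_unique)
    moreover have "?f w = fst w *\<^sub>R a (g y) + snd w *\<^sub>R b (g y)" for w
      unfolding a_def b_def by (rule linear_plane[OF has_derivative_linear[OF f]])
    ultimately have w: "v = fst (?g v) *\<^sub>R a (g y) + snd (?g v) *\<^sub>R b (g y)" for v by metis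
    then have w': "fst v = fst (?g v) * fst (a (g y)) + snd (?g v) * fst (b (g y))"
      "snd v = fst (?g v) * snd (a (g y)) + snd (?g v) * snd (b (g y))" for v
      by (metis fst_add fst_scaleR real_scaleR_def, metis snd_add snd_scaleR real_scaleR_def)
    have "det (g y) * (fst (?g (1,0)) * snd (?g (0,1)) - snd (?g (1,0)) * fst (?g (0,1))) = 1"
      using w'[of "(1,0)"] w'[of "(0,1)"] unfolding det_def fst_conv snd_conv by algebra
    then have nz: "det (g y) \<noteq> 0" by auto
    have "fst (?g v) * det (g y) = fst v * snd (b (g y)) - snd v * fst (b (g y))"
      "snd (?g v) * det (g y) = fst (a (g y)) * snd v - snd (a (g y)) * fst v" for v
      using w'[of v] unfolding det_def by algebra+
    then have "?g v = G (g y) v" for v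
      using nz unfolding G_def by (simp add: prod_eq_iff eq_divide_eq)
    then have "?g = G (g y)" by blast
    then show ?thesis using nz g by simp
  qed
  have "C_k_on k T g" for k
  proof (induction k)
    case 0
    show ?case using dg
      by (auto intro!: continuous_at_imp_continuous_on differentiable_imp_continuous_within)
  next
    case (Suc k)
    define S' where "S' = {x \<in> S. det x \<noteq> 0}"
    have sdet: "smooth_on S det" unfolding det_def
      by (intro smooth_on_diff smooth_on_mult smooth_on_fst smooth_on_snd sm assms(1))
    have "S' = S \<inter> det -` (- {0})" unfolding S'_def by auto
    then have oS': "open S'"
      using continuous_open_preimage[OF smooth_on_imp_continuous_on[OF sdet] assms(1), of "- {0}"] by auto
    have sub: "S' \<subseteq> S" "g ` T \<subseteq> S'" using assms(4) key unfolding S'_def by auto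
    have "smooth_on S' (\<lambda>x. G x v)" for v
      unfolding G_def
      by (intro smooth_on_Pair smooth_on_divide smooth_on_diff smooth_on_mult smooth_on_fst smooth_on_snd
          smooth_on_const oS' smooth_on_subset[OF sm(1) sub(1)] smooth_on_subset[OF sm(2) sub(1)]
          smooth_on_subset[OF sdet sub(1)]) (auto simp: S'_def)
    then have "C_k_on k T (\<lambda>y. G (g y) v)" for v
      using C_k_on_compose[OF \<open>open T\<close> oS' sub(2) Suc.IH] unfolding smooth_on_def by blast
    then show ?case
      using C_k_on_SucI[OF \<open>open T\<close>, of g "\<lambda>y. G (g y)"] key by blast
  qed
  then show ?thesis unfolding smooth_on_def ..
qed

section \<open>Geometry in an arbitrary smooth chart\<close>

lemma top_chart_inj: "top_chart X c \<Longrightarrow> inj_on (snd c) (fst c)"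
  using openin_subset[of X "fst c"]
  unfolding top_chart_def homeomorphic_map_def by (auto simp: inf_absorb2)

lemma top_chart_open_image:
  assumes "top_chart X c" "openin X W"
  shows "open (snd c ` (fst c \<inter> W))"
proof -
  have "openin (subtopology X (fst c)) (fst c \<inter> W)"
    using assms(2) by (rule openin_subtopology_Int2)
  then have "openin (top_of_set (snd c ` fst c)) (snd c ` (fst c \<inter> W))"
    using assms(1) homeomorphic_imp_open_map unfolding top_chart_def open_map_def by blast
  then show ?thesis
    using assms(1) openin_open_eq unfolding top_chart_def by blast
qed

lemma top_chart_openin_preimage:
  assumes "top_chart X c" "open T"
  shows "openin X (fst c \<inter> snd c -` T)"
proof -
  have c: "openin X (fst c)" and
    "continuous_map (subtopology X (fst c)) (top_of_set (snd c ` fst c)) (snd c)"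
    using assms(1) homeomorphic_imp_continuous_map unfolding top_chart_def by blast+
  then have "continuous_map (subtopology X (fst c)) euclidean (snd c)"
    by (simp add: continuous_map_in_subtopology)
  from openin_continuous_map_preimage[OF this, of T]
  have "openin (subtopology X (fst c)) {x \<in> topspace (subtopology X (fst c)). snd c x \<in> T}"
    using assms(2) by simp
  moreover have "{x \<in> topspace (subtopology X (fst c)). snd c x \<in> T} = fst c \<inter> snd c -` T"
    using openin_subset[OF c] by auto
  ultimately show ?thesis
    using openin_trans_full c by metis
qed

lemma inv_into_chart: "top_chart X c \<Longrightarrow> p \<in> fst c \<Longrightarrow> inv_into (fst c) (snd c) (snd c p) = p"
  using top_chart_inj inv_into_f_f by metis

lemma local_rep_at: "top_chart X c \<Longrightarrow> p \<in> fst c \<Longrightarrow> local_rep c F (snd c p) = F p"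
  by (simp add: local_rep_def inv_into_chart)

lemma smooth_chart_top_chart: "smooth_chart M c \<Longrightarrow> top_chart (topol M) c"
  unfolding smooth_chart_def by blast

locale riemannian =
  fixes M :: "'a surface"
  assumes riem: "riemannian_surface M"
begin

lemma atlas_smooth_chart: "c \<in> atlas M \<Longrightarrow> smooth_chart M c"
  using riem unfolding riemannian_surface_def by blast

lemma atlas_covers: "p \<in> points M \<Longrightarrow> \<exists>c\<in>atlas M. p \<in> fst c"
  using riem unfolding riemannian_surface_def by blast

lemma smooth_pos: "smooth_map M (points M) (pos M)"
  using riem unfolding riemannian_surface_def by blast

lemma smooth_chart_subset: "smooth_chart M c \<Longrightarrow> fst c \<subseteq> points M"
  using smooth_chart_top_chart openin_subset unfolding top_chart_def by metis

text \<open>Smoothness is tested on the atlas only; near each point a further chart differs from an atlas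
  chart by a smooth transition map, so the test passes in every chart of the maximal atlas.\<close>

lemma smooth_map_in_chart:
  fixes F :: "'a \<Rightarrow> 'b::real_normed_vector"
  assumes F: "smooth_map M W F" and d: "smooth_chart M d" and W: "openin (topol M) W"
  shows "smooth_on (snd d ` (fst d \<inter> W)) (local_rep d F)"
proof (rule smooth_on_locally)
  fix y assume "y \<in> snd d ` (fst d \<inter> W)"
  then obtain p where p: "p \<in> fst d" "p \<in> W" "y = snd d p" by blast
  then obtain c where c: "c \<in> atlas M" "p \<in> fst c"
    using atlas_covers smooth_chart_subset[OF d] by blast
  have tc: "top_chart (topol M) c" and td: "top_chart (topol M) d"
    using c atlas_smooth_chart d smooth_chart_top_chart by blast+
  have trans: "smooth_transition d c" using d c unfolding smooth_chart_def by blast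
  let ?V = "fst d \<inter> (fst c \<inter> W)"
  let ?T = "snd d ` ?V"
  have oT: "open ?T" using tc W by (intro top_chart_open_image[OF td]) (auto simp: top_chart_def)
  have oS: "open (snd c ` (fst c \<inter> W))" by (rule top_chart_open_image[OF tc W])
  have tr: "smooth_on ?T (local_rep d (snd c))"
    using trans unfolding smooth_transition_def by (rule smooth_on_subset) auto
  have "local_rep d (snd c) ` ?T \<subseteq> snd c ` (fst c \<inter> W)"
    by (intro image_subsetI, elim imageE) (simp add: local_rep_at[OF td] imageI)
  moreover have "smooth_on (snd c ` (fst c \<inter> W)) (local_rep c F)"
    using F c unfolding smooth_map_def by blast
  ultimately have "smooth_on ?T (\<lambda>x. local_rep c F (local_rep d (snd c) x))"
    using smooth_on_compose[OF _ tr oT oS] by blast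
  then have "smooth_on ?T (local_rep d F)"
    by (rule smooth_on_cong[OF oT, rotated]) (auto simp: local_rep_at[OF td] local_rep_at[OF tc])
  then show "\<exists>T. open T \<and> y \<in> T \<and> smooth_on T (local_rep d F)"
    using oT p c by blast
qed

lemma smooth_map_of_chart:
  fixes G :: "real \<times> real \<Rightarrow> 'b::real_normed_vector"
  assumes d: "smooth_chart M d" and W: "openin (topol M) W" "W \<subseteq> fst d" and G: "smooth_on (snd d ` W) G"
  shows "smooth_map M W (\<lambda>p. G (snd d p))"
  unfolding smooth_map_def
proof
  fix c assume c: "c \<in> atlas M"
  have tc: "top_chart (topol M) c" and td: "top_chart (topol M) d"
    using c atlas_smooth_chart d smooth_chart_top_chart by blast+
  have "smooth_transition c d" using d c unfolding smooth_chart_def by blast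
  then have tr: "smooth_on (snd c ` (fst c \<inter> W)) (local_rep c (snd d))"
    unfolding smooth_transition_def by (rule smooth_on_subset) (use W in auto)
  have "fst d \<inter> W = W" using W by blast
  then have o: "open (snd d ` W)" using top_chart_open_image[OF td W(1)] by simp
  have "local_rep c (snd d) ` snd c ` (fst c \<inter> W) \<subseteq> snd d ` W"
    by (intro image_subsetI, elim imageE) (simp add: local_rep_at[OF tc] imageI)
  from smooth_on_compose[OF G tr top_chart_open_image[OF tc W(1)] o this]
  show "smooth_on (snd c ` (fst c \<inter> W)) (local_rep c (\<lambda>p. G (snd d p)))"
    by (rule smooth_on_cong[OF top_chart_open_image[OF tc W(1)], rotated])
      (auto simp: local_rep_at[OF tc])
qed

lemma smooth_map_comp_pos:
  fixes G :: "real ^ 4 \<Rightarrow> 'b::real_normed_vector"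
  assumes W: "openin (topol M) W" and O: "open S" "pos M ` W \<subseteq> S" and G: "smooth_on S G"
  shows "smooth_map M W (\<lambda>p. G (pos M p))"
  unfolding smooth_map_def
proof
  fix c assume c: "c \<in> atlas M"
  have tc: "top_chart (topol M) c" using c atlas_smooth_chart smooth_chart_top_chart by blast
  have "fst c \<inter> W \<subseteq> fst c \<inter> points M" using openin_subset[OF W] by blast
  then have "smooth_on (snd c ` (fst c \<inter> W)) (local_rep c (pos M))"
    using smooth_pos c smooth_on_subset unfolding smooth_map_def by (metis image_mono)
  moreover have "local_rep c (pos M) ` snd c ` (fst c \<inter> W) \<subseteq> S"
    by (intro image_subsetI, elim imageE) (use O(2) in \<open>auto simp: local_rep_at[OF tc]\<close>)
  ultimately have "smooth_on (snd c ` (fst c \<inter> W)) (\<lambda>x. G (local_rep c (pos M) x))"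
    by (rule smooth_on_compose[OF G _ top_chart_open_image[OF tc W] O(1)])
  then show "smooth_on (snd c ` (fst c \<inter> W)) (local_rep c (\<lambda>p. G (pos M p)))"
    by (simp add: local_rep_def comp_def)
qed

lemma smooth_map_openin_preimage:
  fixes F :: "'a \<Rightarrow> 'b::real_normed_vector"
  assumes F: "smooth_map M W F" and W: "openin (topol M) W" and T: "open T"
  shows "openin (topol M) {p \<in> W. F p \<in> T}"
proof (subst openin_subopen, intro ballI)
  fix p assume p: "p \<in> {p \<in> W. F p \<in> T}"
  then obtain c where c: "c \<in> atlas M" "p \<in> fst c"
    using atlas_covers openin_subset[OF W] by blast
  have tc: "top_chart (topol M) c" using c atlas_smooth_chart smooth_chart_top_chart by blast
  let ?S = "snd c ` (fst c \<inter> W)"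
  have "smooth_on ?S (local_rep c F)" using F c unfolding smooth_map_def by blast
  then have o: "open (?S \<inter> local_rep c F -` T)"
    using continuous_open_preimage[OF smooth_on_imp_continuous_on top_chart_open_image[OF tc W] T] by blast
  have "snd c p \<in> ?S \<inter> local_rep c F -` T" using p c local_rep_at[OF tc, of p F] by auto
  moreover have "q \<in> {p \<in> W. F p \<in> T}" if "q \<in> fst c \<inter> snd c -` (?S \<inter> local_rep c F -` T)" for q
    using that top_chart_inj[OF tc] local_rep_at[OF tc, of q F] by (auto dest: inj_onD)
  ultimately show "\<exists>U. openin (topol M) U \<and> p \<in> U \<and> U \<subseteq> {p \<in> W. F p \<in> T}"
    using top_chart_openin_preimage[OF tc o] c(2) by blast
qed

text \<open>The two transition maps between overlapping charts are inverse to each other, so by the chain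
  rule their differentials are.\<close>

lemma transition_differential:
  assumes tc: "top_chart (topol M) c" and td: "top_chart (topol M) d"
    and cd: "smooth_transition c d" and dc: "smooth_transition d c"
    and p: "p \<in> fst c" "p \<in> fst d"
  defines "J \<equiv> frechet_derivative (local_rep c (snd d)) (at (snd c p))"
  shows "(local_rep c (snd d) has_derivative J) (at (snd c p))" and "bij J"
proof -
  let ?K = "frechet_derivative (local_rep d (snd c)) (at (snd d p))"
  have o: "open (snd c ` (fst c \<inter> fst d))" "open (snd d ` (fst d \<inter> fst c))"
    using tc td by (auto intro!: top_chart_open_image simp: top_chart_def)
  show J: "(local_rep c (snd d) has_derivative J) (at (snd c p))"
    using cd p unfolding J_def smooth_transition_def by (intro smooth_on_has_derivative) auto
  have K: "(local_rep d (snd c) has_derivative ?K) (at (snd d p))"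
    using dc p unfolding smooth_transition_def by (intro smooth_on_has_derivative) auto
  have id: "((\<lambda>x. x) has_derivative (\<lambda>v. A (B v))) (at (snd c p))"
    if "top_chart (topol M) c" "top_chart (topol M) d" "p \<in> fst c" "p \<in> fst d"
      "(local_rep c (snd d) has_derivative B) (at (snd c p))"
      "(local_rep d (snd c) has_derivative A) (at (snd d p))" for c d :: "'a chart" and A B
  proof -
    have "((\<lambda>x. local_rep d (snd c) (local_rep c (snd d) x)) has_derivative (\<lambda>v. A (B v))) (at (snd c p))"
      by (rule has_derivative_compose[OF that(5)]) (use that in \<open>simp add: local_rep_at\<close>)
    moreover have "open (snd c ` (fst c \<inter> fst d))"
      using that by (intro top_chart_open_image) (auto simp: top_chart_def)
    ultimately show ?thesis
      by (rule has_derivative_transform_within_open)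
        (use that in \<open>auto simp: local_rep_at[OF that(1)] local_rep_at[OF that(2)]\<close>)
  qed
  have "?K (J v) = v" "J (?K v) = v" for v
    using has_derivative_unique[OF id[OF tc td p J K] has_derivative_ident]
      has_derivative_unique[OF id[OF td tc p(2,1) K J] has_derivative_ident] by metis+
  then show "bij J" by (metis bijI')
qed

lemma frechet_derivative_change:
  fixes F :: "'a \<Rightarrow> 'b::real_normed_vector"
  assumes tc: "top_chart (topol M) c" and td: "top_chart (topol M) d"
    and cd: "smooth_transition c d" and dc: "smooth_transition d c"
    and p: "p \<in> fst c" "p \<in> fst d" and F: "local_rep d F differentiable (at (snd d p))"
  shows "frechet_derivative (local_rep c F) (at (snd c p)) a =
    frechet_derivative (local_rep d F) (at (snd d p)) (frechet_derivative (local_rep c (snd d)) (at (snd c p)) a)"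
proof -
  note J = transition_differential(1)[OF tc td cd dc p]
  have o: "open (snd c ` (fst c \<inter> fst d))"
    using tc td by (auto intro!: top_chart_open_image simp: top_chart_def)
  have "((\<lambda>x. local_rep d F (local_rep c (snd d) x)) has_derivative
      (\<lambda>v. frechet_derivative (local_rep d F) (at (snd d p))
        (frechet_derivative (local_rep c (snd d)) (at (snd c p)) v))) (at (snd c p))"
    by (rule has_derivative_compose[OF J]) (use F p in \<open>simp add: local_rep_at[OF tc] frechet_derivative_works\<close>)
  then have "(local_rep c F has_derivative
      (\<lambda>v. frechet_derivative (local_rep d F) (at (snd d p))
        (frechet_derivative (local_rep c (snd d)) (at (snd c p)) v))) (at (snd c p))"
  proof (rule has_derivative_transform_within_open[OF _ o])
    show "snd c p \<in> snd c ` (fst c \<inter> fst d)" using p by blast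
    show "local_rep d F (local_rep c (snd d) x) = local_rep c F x" if "x \<in> snd c ` (fst c \<inter> fst d)" for x
      using that by (elim imageE) (simp add: local_rep_at[OF tc] local_rep_at[OF td])
  qed
  then show ?thesis by (simp add: frechet_derivative_at[symmetric])
qed

end

text \<open>The tangent spaces and the flat connection are defined through the charts of the atlas. The
  chain rule through the transition maps computes them in any single chart of the maximal atlas, so
  that a chart adapted to the geometry can be used throughout.\<close>

locale chart = riemannian +
  fixes U :: "'a set" and \<sigma> :: "'a \<Rightarrow> real \<times> real"
  assumes smooth: "smooth_chart M (U, \<sigma>)"
begin

definition rep :: "('a \<Rightarrow> 'b) \<Rightarrow> real \<times> real \<Rightarrow> 'b" where "rep = local_rep (U, \<sigma>)"

abbreviation D :: "('a \<Rightarrow> 'b::real_normed_vector) \<Rightarrow> 'a \<Rightarrow> real \<times> real \<Rightarrow> 'b" where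
  "D F p \<equiv> frechet_derivative (rep F) (at (\<sigma> p))"

lemma top: "top_chart (topol M) (U, \<sigma>)"
  using smooth by (rule smooth_chart_top_chart)

lemma openin_U: "openin (topol M) U"
  using top unfolding top_chart_def by simp

lemma U_points: "p \<in> U \<Longrightarrow> p \<in> points M"
  using openin_U openin_subset by blast

lemma open_image: "openin (topol M) W \<Longrightarrow> open (\<sigma> ` (U \<inter> W))"
  using top_chart_open_image[OF top, of W] by simp

lemma open_image_U: "open (\<sigma> ` U)"
  using open_image[OF openin_U] by simp

lemma openin_preimage: "open T \<Longrightarrow> openin (topol M) (U \<inter> \<sigma> -` T)"
  using top_chart_openin_preimage[OF top, of T] by simp

lemma rep_at: "p \<in> U \<Longrightarrow> rep F (\<sigma> p) = F p"
  unfolding rep_def using local_rep_at[OF top, of p F] by simp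

lemma smooth_on_rep:
  fixes F :: "'a \<Rightarrow> 'b::real_normed_vector"
  shows "smooth_map M W F \<Longrightarrow> openin (topol M) W \<Longrightarrow> smooth_on (\<sigma> ` (U \<inter> W)) (rep F)"
  unfolding rep_def using smooth_map_in_chart[OF _ smooth, of W F] by simp

lemma rep_has_derivative:
  fixes F :: "'a \<Rightarrow> 'b::real_normed_vector"
  assumes "smooth_map M W F" "openin (topol M) W" "p \<in> U" "p \<in> W"
  shows "(rep F has_derivative D F p) (at (\<sigma> p))"
  by (rule smooth_on_has_derivative[OF smooth_on_rep[OF assms(1,2)]]) (use assms in auto)

lemma smooth_on_rep_pos: "smooth_on (\<sigma> ` U) (rep (pos M))"
proof -
  have "U \<inter> points M = U" using U_points by blast
  then show ?thesis using smooth_on_rep[OF smooth_pos] by simp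
qed

lemma rep_pos_has_derivative: "p \<in> U \<Longrightarrow> (rep (pos M) has_derivative D (pos M) p) (at (\<sigma> p))"
  using smooth_on_has_derivative[OF smooth_on_rep_pos] by blast

definition transition_diff :: "'a chart \<Rightarrow> 'a \<Rightarrow> real \<times> real \<Rightarrow> real \<times> real" where
  "transition_diff c p = frechet_derivative (local_rep c \<sigma>) (at (snd c p))"

lemma
  assumes "c \<in> atlas M" "p \<in> fst c" "p \<in> U"
  shows bij_transition_diff: "bij (transition_diff c p)"
    and linear_transition_diff: "linear (transition_diff c p)"
    and frechet_derivative_atlas: "\<And>F :: 'a \<Rightarrow> 'b::real_normed_vector.
      rep F differentiable (at (\<sigma> p)) \<Longrightarrow>
      frechet_derivative (local_rep c F) (at (snd c p)) a = D F p (transition_diff c p a)"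
proof -
  let ?d = "(U, \<sigma>)"
  have tc: "top_chart (topol M) c"
    using atlas_smooth_chart[OF assms(1)] smooth_chart_top_chart by blast
  have tr: "smooth_transition c ?d" "smooth_transition ?d c"
    using smooth assms unfolding smooth_chart_def by blast+
  have p: "p \<in> fst ?d" using assms by simp
  show "bij (transition_diff c p)" "linear (transition_diff c p)"
    using transition_differential[OF tc top tr assms(2) p] has_derivative_linear
    unfolding transition_diff_def by auto
  show "frechet_derivative (local_rep c F) (at (snd c p)) a = D F p (transition_diff c p a)"
    if "rep F differentiable (at (\<sigma> p))" for F :: "'a \<Rightarrow> 'b"
    using frechet_derivative_change[OF tc top tr assms(2) p, of F] that
    unfolding rep_def transition_diff_def by simp
qed

lemma rep_pos_differentiable: "p \<in> U \<Longrightarrow> rep (pos M) differentiable (at (\<sigma> p))"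
  using rep_pos_has_derivative differentiableI by blast

lemma tangent_space_chart:
  assumes p: "p \<in> U"
  shows "tangent_space M p = range (D (pos M) p)"
proof -
  have "range (frechet_derivative (local_rep c (pos M)) (at (snd c p))) = range (D (pos M) p)"
    if c: "c \<in> atlas M" "p \<in> fst c" for c
  proof -
    have "frechet_derivative (local_rep c (pos M)) (at (snd c p)) = D (pos M) p \<circ> transition_diff c p"
      by (rule ext) (simp add: frechet_derivative_atlas[OF c p rep_pos_differentiable[OF p]])
    then show ?thesis
      using bij_is_surj[OF bij_transition_diff[OF c p]] by (simp only: image_comp[symmetric])
  qed
  then show ?thesis
    using atlas_covers[OF U_points[OF p]] unfolding tangent_space_def by blast
qed

lemma metric_positive:
  assumes p: "p \<in> U" and "a \<noteq> 0"
  shows "mink (D (pos M) p a) (D (pos M) p a) > 0"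
proof -
  obtain c where c: "c \<in> atlas M" "p \<in> fst c" using atlas_covers[OF U_points[OF p]] by blast
  obtain b where b: "a = transition_diff c p b"
    using bij_is_surj[OF bij_transition_diff[OF c p]] by (meson surjD)
  then have "b \<noteq> 0" using \<open>a \<noteq> 0\<close> linear_0[OF linear_transition_diff[OF c p]] by auto
  moreover have "snd c p \<in> snd c ` fst c" using c by blast
  ultimately have "mink (frechet_derivative (local_rep c (pos M)) (at (snd c p)) b)
      (frechet_derivative (local_rep c (pos M)) (at (snd c p)) b) > 0"
    using riem c unfolding riemannian_surface_def Let_def by blast
  then show ?thesis
    unfolding frechet_derivative_atlas[OF c p rep_pos_differentiable[OF p]] b .
qed

lemma inj_D_pos:
  assumes p: "p \<in> U" and "D (pos M) p a = D (pos M) p b"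
  shows "a = b"
proof (rule ccontr)
  assume "a \<noteq> b"
  then have "mink (D (pos M) p (a - b)) (D (pos M) p (a - b)) > 0" by (intro metric_positive[OF p]) simp
  moreover have "D (pos M) p (a - b) = 0"
    using assms linear_diff[OF has_derivative_linear[OF rep_pos_has_derivative[OF p]]] by simp
  ultimately show False by (simp add: mink_def)
qed

text \<open>The definite description is justified by injectivity of the differential of the position
  vector: a tangent vector determines the coordinate direction in which to differentiate.\<close>

lemma flat_deriv_chart:
  assumes p: "p \<in> U" and F: "rep F differentiable (at (\<sigma> p))"
  shows "flat_deriv M p (D (pos M) p a) F = D F p a"
  unfolding flat_deriv_def
proof (rule the_equality)
  obtain c where c: "c \<in> atlas M" "p \<in> fst c" using atlas_covers[OF U_points[OF p]] by blast
  obtain b where "a = transition_diff c p b"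
    using bij_is_surj[OF bij_transition_diff[OF c p]] by (meson surjD)
  then have "D (pos M) p a = frechet_derivative (local_rep c (pos M)) (at (snd c p)) b"
    "D F p a = frechet_derivative (local_rep c F) (at (snd c p)) b"
    using frechet_derivative_atlas[OF c p rep_pos_differentiable[OF p]]
      frechet_derivative_atlas[OF c p F] by simp_all
  then show "\<exists>c\<in>atlas M. p \<in> fst c \<and>
       (\<exists>b. D (pos M) p a = frechet_derivative (local_rep c (pos M)) (at (snd c p)) b \<and>
            D F p a = frechet_derivative (local_rep c F) (at (snd c p)) b)"
    using c by blast
next
  fix w
  assume "\<exists>c\<in>atlas M. p \<in> fst c \<and>
       (\<exists>b. D (pos M) p a = frechet_derivative (local_rep c (pos M)) (at (snd c p)) b \<and>
            w = frechet_derivative (local_rep c F) (at (snd c p)) b)"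
  then obtain c b where c: "c \<in> atlas M" "p \<in> fst c"
    and b: "D (pos M) p a = frechet_derivative (local_rep c (pos M)) (at (snd c p)) b"
      "w = frechet_derivative (local_rep c F) (at (snd c p)) b" by blast
  then have "D (pos M) p a = D (pos M) p (transition_diff c p b)" "w = D F p (transition_diff c p b)"
    using frechet_derivative_atlas[OF c p rep_pos_differentiable[OF p]]
      frechet_derivative_atlas[OF c p F] by simp_all
  then show "w = D F p a" using inj_D_pos[OF p, of a "transition_diff c p b"] by simp
qed

text \<open>Inverse function theorem: near a point where its differential is injective, a smooth map to
  the plane is a chart of the maximal atlas.\<close>

lemma smooth_chart_of_map:
  fixes G :: "'a \<Rightarrow> real \<times> real"
  assumes W: "openin (topol M) W" and p: "p \<in> U" "p \<in> W" and G: "smooth_map M W G"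
    and inj: "\<And>a. D G p a = 0 \<Longrightarrow> a = 0"
  obtains V where "openin (topol M) V" "p \<in> V" "V \<subseteq> W" "smooth_chart M (V, G)"
proof -
  let ?S = "\<sigma> ` (U \<inter> W)" and ?g = "rep G"
  define g' where "g' x = Blinfun (frechet_derivative ?g (at x))" for x
  have S: "open ?S" by (rule open_image[OF W])
  have sm: "smooth_on ?S ?g" by (rule smooth_on_rep[OF G W])
  have der: "(?g has_derivative frechet_derivative ?g (at x)) (at x)" if "x \<in> ?S" for x
    using smooth_on_has_derivative[OF sm that] .
  have g': "blinfun_apply (g' x) = frechet_derivative ?g (at x)" if "x \<in> ?S" for x
    unfolding g'_def by (rule bounded_linear_Blinfun_apply[OF has_derivative_bounded_linear[OF der[OF that]]])
  have cont: "continuous_on ?S g'"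
  proof (rule continuous_on_blinfun_componentwise)
    fix i :: "real \<times> real"
    have "continuous_on ?S (\<lambda>x. frechet_derivative ?g (at x) i)"
      by (rule smooth_on_imp_continuous_on[OF smooth_on_frechet_derivative[OF sm]])
    then show "continuous_on ?S (\<lambda>x. blinfun_apply (g' x) i)"
      by (rule continuous_on_eq) (simp add: g')
  qed
  have x0: "\<sigma> p \<in> ?S" using p by blast
  have lin: "linear (D G p)" by (rule has_derivative_linear[OF der[OF x0]])
  have "inj (D G p)" using inj linear_injective_0[OF lin] by blast
  then obtain h where h: "linear h" "h \<circ> D G p = id"
    using linear_injective_left_inverse[OF lin] by blast
  have inv: "Blinfun h o\<^sub>L g' (\<sigma> p) = id_blinfun"
  proof (rule blinfun_eqI)
    fix i
    have "blinfun_apply (Blinfun h) = h"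
      by (rule bounded_linear_Blinfun_apply) (use h linear_conv_bounded_linear in blast)
    then show "blinfun_apply (Blinfun h o\<^sub>L g' (\<sigma> p)) i = blinfun_apply id_blinfun i"
      using h(2) by (simp add: g'[OF x0] pointfree_idE)
  qed
  have der': "(?g has_derivative blinfun_apply (g' x)) (at x)" if "x \<in> ?S" for x
    using der[OF that] g'[OF that] by simp
  show ?thesis
  proof (rule inverse_function_theorem[OF S der' cont x0 inv])
    fix S' T k k'
    assume S': "open S'" "S' \<subseteq> ?S" "\<sigma> p \<in> S'" and T: "open T"
      and hom: "homeomorphism S' T ?g k" and k: "\<And>y. y \<in> T \<Longrightarrow> (k has_derivative k' y) (at y)"
    have kS: "k ` T \<subseteq> S'" and gk: "\<And>y. y \<in> T \<Longrightarrow> ?g (k y) = y" and kg: "\<And>x. x \<in> S' \<Longrightarrow> k (?g x) = x"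
      and gS: "?g ` S' = T" using hom unfolding homeomorphism_def by auto
    define V where "V = U \<inter> \<sigma> -` S'"
    have V: "openin (topol M) V" unfolding V_def by (rule openin_preimage[OF S'(1)])
    have VU: "V \<subseteq> U" unfolding V_def by blast
    have VW: "V \<subseteq> W"
    proof
      fix q assume q: "q \<in> V"
      then obtain r where "r \<in> U" "r \<in> W" "\<sigma> q = \<sigma> r" using S'(2) unfolding V_def by auto
      then show "q \<in> W" using top_chart_inj[OF top] q VU by (auto dest: inj_onD)
    qed
    have sV: "\<sigma> ` V = S'" using S'(2) unfolding V_def by auto
    have G\<sigma>: "?g (\<sigma> q) = G q" if "q \<in> V" for q using that VU by (intro rep_at) auto
    have kG: "k (G q) = \<sigma> q" if "q \<in> V" for q
      using kg[of "\<sigma> q"] G\<sigma>[OF that] sV that by auto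
    have "G ` V = ?g ` \<sigma> ` V" using G\<sigma> by (auto simp: image_image)
    then have GV: "G ` V = T" using gS sV by simp
    have injG: "inj_on G V"
    proof (rule inj_onI)
      fix q r assume qr: "q \<in> V" "r \<in> V" "G q = G r"
      then have "\<sigma> q = \<sigma> r" using kG[of q] kG[of r] by simp
      then show "q = r" using top_chart_inj[OF top] qr VU by (auto dest: inj_onD)
    qed
    have smk: "smooth_on T k"
      by (rule smooth_on_inverse_map[OF S T sm])
        (use kS S'(2) gk k differentiableI in blast)+
    have rep_VG: "local_rep (V, G) F y = rep F (k y)" if y: "y \<in> T" for F :: "'a \<Rightarrow> real \<times> real" and y
    proof -
      obtain q where q: "q \<in> V" "y = G q" using GV y by blast
      then show ?thesis
        using injG kG VU by (auto simp: local_rep_def[of "(V, G)"] inv_into_f_f rep_at)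
    qed
    have top': "top_chart (topol M) (V, G)"
      unfolding top_chart_def fst_conv snd_conv
    proof (intro conjI)
      show "openin (topol M) V" by (rule V)
      show "open (G ` V)" using GV T by simp
      have tV: "topspace (subtopology (topol M) V) = V" using openin_subset[OF V] by auto
      have "continuous_map (subtopology (topol M) V) euclidean G"
        unfolding continuous_map_def tV
      proof (intro conjI allI impI)
        fix B :: "(real \<times> real) set" assume "openin euclidean B"
        then have B: "open B" by simp
        have "openin (topol M) {q \<in> W. G q \<in> B}" by (rule smooth_map_openin_preimage[OF G W B])
        then have "openin (subtopology (topol M) V) (V \<inter> {q \<in> W. G q \<in> B})"
          by (rule openin_subtopology_Int2)
        moreover have "V \<inter> {q \<in> W. G q \<in> B} = {q \<in> V. G q \<in> B}" using VW by blast
        ultimately show "openin (subtopology (topol M) V) {q \<in> V. G q \<in> B}" by simp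
      qed simp
      then have c: "continuous_map (subtopology (topol M) V) (top_of_set (G ` V)) G"
        by (simp add: continuous_map_in_subtopology tV)
      have "open_map (subtopology (topol M) V) (top_of_set (G ` V)) G"
        unfolding open_map_def
      proof (intro allI impI)
        fix A assume "openin (subtopology (topol M) V) A"
        then have A: "openin (topol M) A" "A \<subseteq> V" using openin_open_subtopology[OF V] by auto
        have "U \<inter> A = A" using A VU by blast
        then have oA: "open (\<sigma> ` A)" using open_image[OF A(1)] by simp
        have "G ` A = T \<inter> k -` (\<sigma> ` A)"
        proof (intro equalityI subsetI)
          fix y assume "y \<in> G ` A"
          then show "y \<in> T \<inter> k -` (\<sigma> ` A)" using A(2) GV kG by fastforce
        next
          fix y assume y: "y \<in> T \<inter> k -` (\<sigma> ` A)"
          then obtain q where q: "q \<in> A" "k y = \<sigma> q" by blast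
          then have "y = G q" using gk[of y] y G\<sigma>[of q] A(2) by auto
          then show "y \<in> G ` A" using q by blast
        qed
        then have "open (G ` A)"
          using continuous_open_preimage[OF smooth_on_imp_continuous_on[OF smk] T oA] by simp
        then show "openin (top_of_set (G ` V)) (G ` A)"
          using openin_open_eq[of "G ` V" "G ` A"] GV T A(2) by auto
      qed
      then show "homeomorphic_map (subtopology (topol M) V) (top_of_set (G ` V)) G"
        using c injG tV by (intro bijective_open_imp_homeomorphic_map) auto
    qed
    have "smooth_chart M (V, G)"
      unfolding smooth_chart_def
    proof (intro conjI ballI)
      show "top_chart (topol M) (V, G)" by (rule top')
      fix d assume d: "d \<in> atlas M"
      have td: "top_chart (topol M) d" using d atlas_smooth_chart smooth_chart_top_chart by blast
      have o: "open (G ` (V \<inter> fst d))"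
        using top_chart_open_image[OF top', of "fst d"] td unfolding top_chart_def by simp
      have o2: "open (\<sigma> ` (U \<inter> fst d))" using open_image td unfolding top_chart_def by blast
      have "smooth_on (\<sigma> ` (U \<inter> fst d)) (rep (snd d))"
        using smooth d unfolding smooth_chart_def smooth_transition_def rep_def by simp
      moreover have "smooth_on (G ` (V \<inter> fst d)) k" using smk by (rule smooth_on_subset) (use GV in auto)
      ultimately have "smooth_on (G ` (V \<inter> fst d)) (\<lambda>y. rep (snd d) (k y))"
        by (rule smooth_on_compose[OF _ _ o o2]) (use kG VU in auto)
      then show "smooth_transition (V, G) d"
        unfolding smooth_transition_def fst_conv snd_conv
      proof (rule smooth_on_cong[OF o, rotated])
        fix y assume "y \<in> G ` (V \<inter> fst d)"
        then have "y \<in> T" using GV by blast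
        then show "rep (snd d) (k y) = local_rep (V, G) (snd d) y" by (rule rep_VG[symmetric])
      qed
      show "smooth_transition d (V, G)"
        unfolding smooth_transition_def fst_conv snd_conv
      proof (rule smooth_on_subset)
        show "smooth_on (snd d ` (fst d \<inter> W)) (local_rep d G)" using G d unfolding smooth_map_def by blast
        show "snd d ` (fst d \<inter> V) \<subseteq> snd d ` (fst d \<inter> W)" using VW by blast
      qed
    qed
    moreover have "p \<in> V" using p S'(3) unfolding V_def by simp
    ultimately show ?thesis using that V VW by blast
  qed
qed

end

section \<open>Orthonormal frames\<close>

lemma mink_inner: "mink u v = u \<bullet> v - 2 * (u $ 1 * v $ 1)"
  by (simp add: mink_def inner_vec_def sum_diff1)

lemma bounded_bilinear_mink: "bounded_bilinear (mink :: real ^ 'n::{finite, one} \<Rightarrow> _)"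
  by (subst bilinear_conv_bounded_bilinear[symmetric])
    (auto simp: bilinear_def mink_inner inner_simps algebra_simps intro!: linearI)

lemmas mink_add_left = bounded_bilinear.add_left[OF bounded_bilinear_mink]
  and mink_add_right = bounded_bilinear.add_right[OF bounded_bilinear_mink]
  and mink_diff_left = bounded_bilinear.diff_left[OF bounded_bilinear_mink]
  and mink_diff_right = bounded_bilinear.diff_right[OF bounded_bilinear_mink]
  and mink_minus_left = bounded_bilinear.minus_left[OF bounded_bilinear_mink]
  and mink_minus_right = bounded_bilinear.minus_right[OF bounded_bilinear_mink]
  and mink_scaleR_left = bounded_bilinear.scaleR_left[OF bounded_bilinear_mink]
  and mink_scaleR_right = bounded_bilinear.scaleR_right[OF bounded_bilinear_mink]
  and mink_zero_left = bounded_bilinear.zero_left[OF bounded_bilinear_mink]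
  and mink_zero_right = bounded_bilinear.zero_right[OF bounded_bilinear_mink]

lemmas mink_simps = mink_add_left mink_add_right mink_diff_left mink_diff_right mink_minus_left
  mink_minus_right mink_scaleR_left mink_scaleR_right mink_zero_left mink_zero_right

lemma mink_commute: "mink u v = mink v u"
  by (simp add: mink_inner inner_commute)

lemmas smooth_on_mink = smooth_on_bilinear[OF bounded_bilinear_mink]

lemma orthonormal_columns:
  fixes a b c d :: real
  assumes "a * a + b * b = 1" "c * c + d * d = 1" "a * c + b * d = 0"
  shows "a * a + c * c = 1" "b * b + d * d = 1" "a * b + c * d = 0"
proof -
  \<comment> \<open>\<open>D = \<plusminus>1\<close> is the determinant, and Cramer's rule expresses the first row through the second\<close>
  define D where "D = a * d - b * c"
  have "a * (c * c + d * d) - c * (a * c + b * d) = d * D" "b * (c * c + d * d) - d * (a * c + b * d) = - (c * D)"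
    unfolding D_def by (simp_all add: algebra_simps)
  then have ab: "a = d * D" "b = - (c * D)"
    using assms by simp_all
  have "D * D = (a * a + b * b) * (c * c + d * d) - (a * c + b * d) * (a * c + b * d)"
    unfolding D_def by (simp add: algebra_simps)
  then have D: "D * D = 1" using assms by simp
  have "a * a + c * c = (D * D) * (d * d) + c * c" "b * b + d * d = (D * D) * (c * c) + d * d"
    "a * b + c * d = c * d * (1 - D * D)"
    by (simp_all only: ab) (simp_all add: algebra_simps)
  then show "a * a + c * c = 1" "b * b + d * d = 1" "a * b + c * d = 0"
    using D assms(2) by simp_all
qed

text \<open>A chart whose coordinate vector fields are orthogonal and the first of which has unit length:
  \<open>E1\<close> is the first coordinate field, and \<open>E2\<close> the second one divided by the signed factor \<open>g\<close>.\<close>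

locale frame_chart = chart +
  fixes E1 E2 :: "real \<times> real \<Rightarrow> real ^ 4" and g :: "real \<times> real \<Rightarrow> real"
  assumes smooth_E1: "smooth_on (\<sigma> ` U) E1" and smooth_E2: "smooth_on (\<sigma> ` U) E2"
    and E1_E1: "x \<in> \<sigma> ` U \<Longrightarrow> mink (E1 x) (E1 x) = 1"
    and E2_E2: "x \<in> \<sigma> ` U \<Longrightarrow> mink (E2 x) (E2 x) = 1"
    and E1_E2: "x \<in> \<sigma> ` U \<Longrightarrow> mink (E1 x) (E2 x) = 0"
    and g_nonzero: "x \<in> \<sigma> ` U \<Longrightarrow> g x \<noteq> 0"
    and D_pos: "p \<in> U \<Longrightarrow> D (pos M) p a = fst a *\<^sub>R E1 (\<sigma> p) + (snd a * g (\<sigma> p)) *\<^sub>R E2 (\<sigma> p)"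
begin

definition nor :: "real \<times> real \<Rightarrow> real ^ 4 \<Rightarrow> real ^ 4" where
  "nor x v = v - mink v (E1 x) *\<^sub>R E1 x - mink v (E2 x) *\<^sub>R E2 x"

abbreviation DE1 :: "real \<times> real \<Rightarrow> real \<times> real \<Rightarrow> real ^ 4" where
  "DE1 x \<equiv> frechet_derivative E1 (at x)"

abbreviation DE2 :: "real \<times> real \<Rightarrow> real \<times> real \<Rightarrow> real ^ 4" where
  "DE2 x \<equiv> frechet_derivative E2 (at x)"

lemma frame_simps:
  assumes "p \<in> U"
  shows "mink (E1 (\<sigma> p)) (E1 (\<sigma> p)) = 1" "mink (E2 (\<sigma> p)) (E2 (\<sigma> p)) = 1"
    "mink (E1 (\<sigma> p)) (E2 (\<sigma> p)) = 0" "mink (E2 (\<sigma> p)) (E1 (\<sigma> p)) = 0" "g (\<sigma> p) \<noteq> 0"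
  using E1_E1[of "\<sigma> p"] E2_E2[of "\<sigma> p"] E1_E2[of "\<sigma> p"] g_nonzero[of "\<sigma> p"] assms
  by (simp_all add: mink_commute[of "E2 _" "E1 _"])

lemma DE1: "p \<in> U \<Longrightarrow> (E1 has_derivative DE1 (\<sigma> p)) (at (\<sigma> p))"
  and DE2: "p \<in> U \<Longrightarrow> (E2 has_derivative DE2 (\<sigma> p)) (at (\<sigma> p))"
  using smooth_on_has_derivative[OF smooth_E1] smooth_on_has_derivative[OF smooth_E2] by auto

lemma frame_vector:
  assumes "p \<in> U"
  shows "a *\<^sub>R E1 (\<sigma> p) + b *\<^sub>R E2 (\<sigma> p) = D (pos M) p (a, b / g (\<sigma> p))"
  using D_pos[OF assms] frame_simps[OF assms] by simp

lemma tangent_space_frame: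
  assumes p: "p \<in> U"
  shows "v \<in> tangent_space M p \<longleftrightarrow> (\<exists>a b. v = a *\<^sub>R E1 (\<sigma> p) + b *\<^sub>R E2 (\<sigma> p))"
proof
  assume "v \<in> tangent_space M p"
  then obtain a where "v = D (pos M) p a" using tangent_space_chart[OF p] by blast
  then show "\<exists>a b. v = a *\<^sub>R E1 (\<sigma> p) + b *\<^sub>R E2 (\<sigma> p)" using D_pos[OF p] by blast
next
  assume "\<exists>a b. v = a *\<^sub>R E1 (\<sigma> p) + b *\<^sub>R E2 (\<sigma> p)"
  then show "v \<in> tangent_space M p" using frame_vector[OF p] tangent_space_chart[OF p] by auto
qed

lemma E1_tangent: "p \<in> U \<Longrightarrow> E1 (\<sigma> p) \<in> tangent_space M p"
  using tangent_space_frame[of p] by (metis add.right_neutral scaleR_one scaleR_zero_left)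

lemma E2_tangent: "p \<in> U \<Longrightarrow> E2 (\<sigma> p) \<in> tangent_space M p"
  using tangent_space_frame[of p] by (metis add_0 scaleR_one scaleR_zero_left)

lemma tan_part_frame:
  assumes p: "p \<in> U"
  shows "tan_part M p v = mink v (E1 (\<sigma> p)) *\<^sub>R E1 (\<sigma> p) + mink v (E2 (\<sigma> p)) *\<^sub>R E2 (\<sigma> p)"
  unfolding tan_part_def
proof (rule the_equality)
  let ?w = "mink v (E1 (\<sigma> p)) *\<^sub>R E1 (\<sigma> p) + mink v (E2 (\<sigma> p)) *\<^sub>R E2 (\<sigma> p)"
  have "mink (v - ?w) u = 0" if "u \<in> tangent_space M p" for u
  proof -
    obtain a b where "u = a *\<^sub>R E1 (\<sigma> p) + b *\<^sub>R E2 (\<sigma> p)"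
      using \<open>u \<in> tangent_space M p\<close> tangent_space_frame[OF p] by blast
    then show ?thesis by (simp add: mink_simps frame_simps[OF p] algebra_simps)
  qed
  then show "?w \<in> tangent_space M p \<and> (\<forall>u\<in>tangent_space M p. mink (v - ?w) u = 0)"
    using tangent_space_frame[OF p] by blast
next
  fix w assume w: "w \<in> tangent_space M p \<and> (\<forall>u\<in>tangent_space M p. mink (v - w) u = 0)"
  then obtain a b where ab: "w = a *\<^sub>R E1 (\<sigma> p) + b *\<^sub>R E2 (\<sigma> p)"
    using tangent_space_frame[OF p] by blast
  have "mink (v - w) (E1 (\<sigma> p)) = 0" "mink (v - w) (E2 (\<sigma> p)) = 0"
    using w E1_tangent[OF p] E2_tangent[OF p] by blast+
  then have "mink v (E1 (\<sigma> p)) = a" "mink v (E2 (\<sigma> p)) = b"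
    unfolding ab by (simp_all add: mink_simps frame_simps[OF p])
  then show "w = mink v (E1 (\<sigma> p)) *\<^sub>R E1 (\<sigma> p) + mink v (E2 (\<sigma> p)) *\<^sub>R E2 (\<sigma> p)"
    using ab by simp
qed

lemma nor_part_frame: "p \<in> U \<Longrightarrow> nor_part M p v = nor (\<sigma> p) v"
  unfolding nor_part_def nor_def by (simp add: tan_part_frame)

lemma nor_add: "nor x (v + w) = nor x v + nor x w"
  and nor_scaleR: "nor x (a *\<^sub>R v) = a *\<^sub>R nor x v"
  unfolding nor_def by (simp_all add: mink_simps algebra_simps)

lemma nor_frame: "p \<in> U \<Longrightarrow> nor (\<sigma> p) (E1 (\<sigma> p)) = 0" "p \<in> U \<Longrightarrow> nor (\<sigma> p) (E2 (\<sigma> p)) = 0"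
  unfolding nor_def by (simp_all add: frame_simps)

lemma flat_deriv_frame:
  assumes p: "p \<in> U" and FG: "\<And>q. q \<in> U \<Longrightarrow> F q = G (\<sigma> q)" and G: "(G has_derivative G') (at (\<sigma> p))"
  shows "flat_deriv M p (a *\<^sub>R E1 (\<sigma> p) + b *\<^sub>R E2 (\<sigma> p)) F = G' (a, b / g (\<sigma> p))"
proof -
  have "(rep F has_derivative G') (at (\<sigma> p))"
  proof (rule has_derivative_transform_within_open[OF G open_image_U])
    show "\<sigma> p \<in> \<sigma> ` U" using p by blast
    show "G x = rep F x" if "x \<in> \<sigma> ` U" for x
      using that by (elim imageE) (simp add: rep_at FG)
  qed
  then have "rep F differentiable (at (\<sigma> p))" "D F p = G'"
    using differentiableI frechet_derivative_at by (blast, metis)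
  then show ?thesis using flat_deriv_chart[OF p, of F] frame_vector[OF p] by simp
qed

text \<open>Differentiating a tangent field \<open>Y = y\<^sub>1 E\<^sub>1 + y\<^sub>2 E\<^sub>2\<close> gives the derivatives of the
  \<open>y\<^sub>i\<close> only as coefficients of the frame, and the normal projection removes them. So only the
  value of \<open>Y\<close> at the point matters.\<close>

lemma second_ff_frame:
  assumes p: "p \<in> U"
  shows "second_ff M p (a *\<^sub>R E1 (\<sigma> p) + b *\<^sub>R E2 (\<sigma> p)) (c *\<^sub>R E1 (\<sigma> p) + d *\<^sub>R E2 (\<sigma> p)) =
    nor (\<sigma> p) (c *\<^sub>R DE1 (\<sigma> p) (a, b / g (\<sigma> p)) + d *\<^sub>R DE2 (\<sigma> p) (a, b / g (\<sigma> p)))"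
    (is "second_ff M p ?v ?w = ?n")
  unfolding second_ff_def
proof (rule the_equality)
  let ?Y = "\<lambda>q. c *\<^sub>R E1 (\<sigma> q) + d *\<^sub>R E2 (\<sigma> q)"
  have "smooth_on (\<sigma> ` U) (\<lambda>x. c *\<^sub>R E1 x + d *\<^sub>R E2 x)"
    by (intro smooth_on_add smooth_on_scaleR smooth_on_const smooth_E1 smooth_E2 open_image_U)
  then have "smooth_map M U ?Y"
    using smooth_map_of_chart[OF smooth openin_U, of "\<lambda>x. c *\<^sub>R E1 x + d *\<^sub>R E2 x"] by simp
  moreover have "?Y q \<in> tangent_space M q" if "q \<in> U" for q
    unfolding tangent_space_frame[OF that] by blast
  ultimately have tf: "tangent_field M U ?Y" unfolding tangent_field_def by blast
  have "((\<lambda>x. c *\<^sub>R E1 x + d *\<^sub>R E2 x) has_derivative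
      (\<lambda>h. c *\<^sub>R DE1 (\<sigma> p) h + d *\<^sub>R DE2 (\<sigma> p) h)) (at (\<sigma> p))"
    by (intro has_derivative_add has_derivative_scaleR_right DE1 DE2 p)
  from flat_deriv_frame[OF p _ this, of ?Y a b]
  have "?n = nor_part M p (flat_deriv M p ?v ?Y)" by (simp add: nor_part_frame[OF p])
  then show "\<exists>W Y. openin (topol M) W \<and> p \<in> W \<and> tangent_field M W Y \<and> Y p = ?w \<and>
      ?n = nor_part M p (flat_deriv M p ?v Y)"
    using openin_U p tf by blast
next
  fix n
  assume "\<exists>W Y. openin (topol M) W \<and> p \<in> W \<and> tangent_field M W Y \<and> Y p = ?w \<and>
      n = nor_part M p (flat_deriv M p ?v Y)"
  then obtain W Y where W: "openin (topol M) W" "p \<in> W" and Y: "tangent_field M W Y" "Y p = ?w"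
    and n: "n = nor_part M p (flat_deriv M p ?v Y)" by blast
  let ?S = "\<sigma> ` (U \<inter> W)" and ?h = "(a, b / g (\<sigma> p))"
  define y1 y2 where "y1 x = mink (rep Y x) (E1 x)" and "y2 x = mink (rep Y x) (E2 x)" for x
  have S: "open ?S" "\<sigma> p \<in> ?S" "?S \<subseteq> \<sigma> ` U" using open_image[OF W(1)] p W by auto
  have smY: "smooth_on ?S (rep Y)"
    using Y(1) W(1) smooth_on_rep unfolding tangent_field_def by blast
  have "smooth_on ?S y1" "smooth_on ?S y2"
    unfolding y1_def y2_def
    using smooth_on_mink[OF S(1) smY] smooth_on_subset[OF _ S(3)] smooth_E1 smooth_E2 by blast+
  then obtain y1' y2' where y': "(y1 has_derivative y1') (at (\<sigma> p))" "(y2 has_derivative y2') (at (\<sigma> p))"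
    using smooth_on_has_derivative S(2) by blast
  have Yy: "y1 x *\<^sub>R E1 x + y2 x *\<^sub>R E2 x = rep Y x" if "x \<in> ?S" for x
  proof -
    obtain q where q: "q \<in> U" "q \<in> W" "x = \<sigma> q" using \<open>x \<in> ?S\<close> by blast
    have "Y q \<in> tangent_space M q" using Y(1) q unfolding tangent_field_def by blast
    then obtain s t where "Y q = s *\<^sub>R E1 (\<sigma> q) + t *\<^sub>R E2 (\<sigma> q)" using tangent_space_frame[OF q(1)] by blast
    then show ?thesis
      unfolding y1_def y2_def using q by (simp add: rep_at mink_simps frame_simps)
  qed
  have "((\<lambda>x. y1 x *\<^sub>R E1 x + y2 x *\<^sub>R E2 x) has_derivative
      (\<lambda>h. (y1 (\<sigma> p) *\<^sub>R DE1 (\<sigma> p) h + y1' h *\<^sub>R E1 (\<sigma> p)) + (y2 (\<sigma> p) *\<^sub>R DE2 (\<sigma> p) h + y2' h *\<^sub>R E2 (\<sigma> p))))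
      (at (\<sigma> p))"
    by (intro has_derivative_add has_derivative_scaleR y' DE1 DE2 p)
  from has_derivative_transform_within_open[OF this S(1,2) Yy]
  have der: "(rep Y has_derivative
      (\<lambda>h. (y1 (\<sigma> p) *\<^sub>R DE1 (\<sigma> p) h + y1' h *\<^sub>R E1 (\<sigma> p)) + (y2 (\<sigma> p) *\<^sub>R DE2 (\<sigma> p) h + y2' h *\<^sub>R E2 (\<sigma> p))))
      (at (\<sigma> p))" by simp
  have "y1 (\<sigma> p) = c" "y2 (\<sigma> p) = d"
    unfolding y1_def y2_def using p Y(2) by (simp_all add: rep_at mink_simps frame_simps)
  with flat_deriv_frame[OF p rep_at[symmetric] der]
  have "flat_deriv M p ?v Y = (c *\<^sub>R DE1 (\<sigma> p) ?h + y1' ?h *\<^sub>R E1 (\<sigma> p)) +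
      (d *\<^sub>R DE2 (\<sigma> p) ?h + y2' ?h *\<^sub>R E2 (\<sigma> p))" by simp
  then show "n = ?n"
    unfolding n nor_part_frame[OF p] by (simp add: nor_add nor_scaleR nor_frame[OF p])
qed

text \<open>The trace of a bilinear form is the same in all orthonormal bases because the columns of an
  orthogonal matrix are orthonormal. The mixed terms \<open>h(E1, E2)\<close> and \<open>h(E2, E1)\<close> share the
  coefficient that vanishes.\<close>

lemma mean_curv_frame:
  assumes p: "p \<in> U"
  shows "mean_curv M p = (1 / 2) *\<^sub>R nor (\<sigma> p) (DE1 (\<sigma> p) (1, 0) + DE2 (\<sigma> p) (0, 1 / g (\<sigma> p)))"
    (is "_ = ?H")
  unfolding mean_curv_def
proof (rule the_equality)
  have H: "?H = (1 / 2) *\<^sub>R (second_ff M p (E1 (\<sigma> p)) (E1 (\<sigma> p)) + second_ff M p (E2 (\<sigma> p)) (E2 (\<sigma> p)))"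
    using second_ff_frame[OF p, of 1 0 1 0] second_ff_frame[OF p, of 0 1 0 1] by (simp add: nor_add)
  show "\<exists>e\<^sub>1\<in>tangent_space M p. \<exists>e\<^sub>2\<in>tangent_space M p.
      mink e\<^sub>1 e\<^sub>1 = 1 \<and> mink e\<^sub>2 e\<^sub>2 = 1 \<and> mink e\<^sub>1 e\<^sub>2 = 0 \<and>
      ?H = (1 / 2) *\<^sub>R (second_ff M p e\<^sub>1 e\<^sub>1 + second_ff M p e\<^sub>2 e\<^sub>2)"
    by (rule bexI[OF _ E1_tangent[OF p]], rule bexI[OF _ E2_tangent[OF p]])
      (intro conjI frame_simps(1-3)[OF p] H)
next
  fix n
  assume "\<exists>e\<^sub>1\<in>tangent_space M p. \<exists>e\<^sub>2\<in>tangent_space M p.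
      mink e\<^sub>1 e\<^sub>1 = 1 \<and> mink e\<^sub>2 e\<^sub>2 = 1 \<and> mink e\<^sub>1 e\<^sub>2 = 0 \<and>
      n = (1 / 2) *\<^sub>R (second_ff M p e\<^sub>1 e\<^sub>1 + second_ff M p e\<^sub>2 e\<^sub>2)"
  then obtain e1 e2 where "e1 \<in> tangent_space M p" "e2 \<in> tangent_space M p"
    and e12: "mink e1 e1 = 1" "mink e2 e2 = 1" "mink e1 e2 = 0"
      "n = (1 / 2) *\<^sub>R (second_ff M p e1 e1 + second_ff M p e2 e2)" by (elim bexE conjE) (rule that)
  then obtain a b c d where ab: "e1 = a *\<^sub>R E1 (\<sigma> p) + b *\<^sub>R E2 (\<sigma> p)"
    and cd: "e2 = c *\<^sub>R E1 (\<sigma> p) + d *\<^sub>R E2 (\<sigma> p)"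
    unfolding tangent_space_frame[OF p] by (elim exE) (rule that)
  note e = e12(1-3)[unfolded ab cd]
  note n = e12(4)[unfolded ab cd]
  have rows: "a * a + b * b = 1" "c * c + d * d = 1" "a * c + b * d = 0"
    using e by (simp_all add: mink_simps frame_simps[OF p] algebra_simps)
  note cols = orthonormal_columns[OF rows]
  define P1 P2 Q1 Q2 where "P1 = DE1 (\<sigma> p) (1, 0)" and "P2 = DE2 (\<sigma> p) (1, 0)"
    and "Q1 = DE1 (\<sigma> p) (0, 1 / g (\<sigma> p))" and "Q2 = DE2 (\<sigma> p) (0, 1 / g (\<sigma> p))"
  have lin: "h (s, t / g (\<sigma> p)) = s *\<^sub>R h (1, 0) + t *\<^sub>R h (0, 1 / g (\<sigma> p))"
    if "linear h" for h :: "real \<times> real \<Rightarrow> real ^ 4" and s t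
    using linear_plane[OF that, of "(s, t / g (\<sigma> p))"] linear_plane[OF that, of "(0, 1 / g (\<sigma> p))"]
    by simp
  have "n = (1 / 2) *\<^sub>R nor (\<sigma> p) ((a *\<^sub>R (a *\<^sub>R P1 + b *\<^sub>R Q1) + b *\<^sub>R (a *\<^sub>R P2 + b *\<^sub>R Q2)) +
      (c *\<^sub>R (c *\<^sub>R P1 + d *\<^sub>R Q1) + d *\<^sub>R (c *\<^sub>R P2 + d *\<^sub>R Q2)))"
    unfolding n second_ff_frame[OF p] P1_def P2_def Q1_def Q2_def nor_add[symmetric]
    by (simp only: lin[OF has_derivative_linear[OF DE1[OF p]], of a b] lin[OF has_derivative_linear[OF DE2[OF p]], of a b]
        lin[OF has_derivative_linear[OF DE1[OF p]], of c d] lin[OF has_derivative_linear[OF DE2[OF p]], of c d])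
  also have "(a *\<^sub>R (a *\<^sub>R P1 + b *\<^sub>R Q1) + b *\<^sub>R (a *\<^sub>R P2 + b *\<^sub>R Q2)) +
      (c *\<^sub>R (c *\<^sub>R P1 + d *\<^sub>R Q1) + d *\<^sub>R (c *\<^sub>R P2 + d *\<^sub>R Q2)) =
      (a * a + c * c) *\<^sub>R P1 + (b * b + d * d) *\<^sub>R Q2 + (a * b + c * d) *\<^sub>R (Q1 + P2)"
    by (simp only: scaleR_add_left scaleR_add_right scaleR_scaleR ac_simps)
  also have "\<dots> = P1 + Q2" unfolding cols by simp
  finally show "n = ?H" unfolding P1_def Q2_def .
qed

lemma shape_op_tangent:
  assumes p: "p \<in> U" and w: "w \<in> tangent_space M p"
  shows "mink (shape_op M \<xi> p v) w = - mink (flat_deriv M p v \<xi>) w"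
proof -
  obtain a b where "w = a *\<^sub>R E1 (\<sigma> p) + b *\<^sub>R E2 (\<sigma> p)" using w tangent_space_frame[OF p] by blast
  then show ?thesis
    unfolding shape_op_def by (simp add: tan_part_frame[OF p] mink_simps frame_simps[OF p])
qed

text \<open>Weingarten's relation \<open>\<langle>A\<^sub>N X, Y\<rangle> = \<langle>N, D\<^sub>X Y\<rangle>\<close>, from differentiating
  \<open>\<langle>N, E\<^sub>i\<rangle> = 0\<close>.\<close>

lemma shape_op_frame:
  assumes p: "p \<in> U" and \<xi>: "\<And>q. q \<in> U \<Longrightarrow> \<xi> q = N (\<sigma> q)" and N: "(N has_derivative N') (at (\<sigma> p))"
    and normal: "\<And>x. x \<in> \<sigma> ` U \<Longrightarrow> mink (N x) (E1 x) = 0" "\<And>x. x \<in> \<sigma> ` U \<Longrightarrow> mink (N x) (E2 x) = 0"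
  shows "mink (shape_op M \<xi> p (a *\<^sub>R E1 (\<sigma> p) + b *\<^sub>R E2 (\<sigma> p))) (c *\<^sub>R E1 (\<sigma> p) + d *\<^sub>R E2 (\<sigma> p)) =
    mink (N (\<sigma> p)) (c *\<^sub>R DE1 (\<sigma> p) (a, b / g (\<sigma> p)) + d *\<^sub>R DE2 (\<sigma> p) (a, b / g (\<sigma> p)))"
proof -
  have *: "mink (N (\<sigma> p)) (E' h) + mink (N' h) (E (\<sigma> p)) = 0"
    if E: "(E has_derivative E') (at (\<sigma> p))" and orth: "\<And>x. x \<in> \<sigma> ` U \<Longrightarrow> mink (N x) (E x) = 0"
    for E :: "real \<times> real \<Rightarrow> real ^ 4" and E' h
  proof -
    have "((\<lambda>x. mink (N x) (E x)) has_derivative (\<lambda>h. mink (N (\<sigma> p)) (E' h) + mink (N' h) (E (\<sigma> p)))) (at (\<sigma> p))"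
      by (rule bounded_bilinear.FDERIV[OF bounded_bilinear_mink N E])
    moreover have "((\<lambda>x. mink (N x) (E x)) has_derivative (\<lambda>h. 0)) (at (\<sigma> p))"
      by (rule has_derivative_transform_within_open[OF has_derivative_const open_image_U])
        (use p in blast, rule orth[symmetric])
    ultimately have "(\<lambda>h. mink (N (\<sigma> p)) (E' h) + mink (N' h) (E (\<sigma> p))) = (\<lambda>h. 0)"
      by (rule has_derivative_unique)
    then show ?thesis by (rule fun_cong)
  qed
  have "c *\<^sub>R E1 (\<sigma> p) + d *\<^sub>R E2 (\<sigma> p) \<in> tangent_space M p" unfolding tangent_space_frame[OF p] by blast
  from shape_op_tangent[OF p this]
  have "mink (shape_op M \<xi> p (a *\<^sub>R E1 (\<sigma> p) + b *\<^sub>R E2 (\<sigma> p))) (c *\<^sub>R E1 (\<sigma> p) + d *\<^sub>R E2 (\<sigma> p)) =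
      - c * mink (N' (a, b / g (\<sigma> p))) (E1 (\<sigma> p)) - d * mink (N' (a, b / g (\<sigma> p))) (E2 (\<sigma> p))"
    by (simp add: flat_deriv_frame[OF p \<xi> N] mink_simps)
  moreover have "mink (N' h) (E1 (\<sigma> p)) = - mink (N (\<sigma> p)) (DE1 (\<sigma> p) h)"
    "mink (N' h) (E2 (\<sigma> p)) = - mink (N (\<sigma> p)) (DE2 (\<sigma> p) h)" for h
    using *[OF DE1[OF p] normal(1), of h] *[OF DE2[OF p] normal(2), of h] by simp_all
  ultimately show ?thesis by (simp add: mink_simps)
qed

end

section \<open>Surfaces generated by a curve of null vectors\<close>

lemma vector_4:
  "(vector [x, y, z, w] :: 'a::zero ^ 4) $ 1 = x" "(vector [x, y, z, w] :: 'a ^ 4) $ 2 = y"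
  "(vector [x, y, z, w] :: 'a ^ 4) $ 3 = z" "(vector [x, y, z, w] :: 'a ^ 4) $ 4 = w"
  unfolding vector_def by simp_all

lemma mink_d4: "mink v d4 = v $ 4"
  by (simp add: mink_inner inner_axis) (simp add: axis_def)

text \<open>The coordinates of the charts below are called \<open>(z, v)\<close>; \<open>z\<close> will be the height \<open>x\<^sub>4\<close>.\<close>

abbreviation dz :: "(real \<times> real \<Rightarrow> 'b::real_normed_vector) \<Rightarrow> real \<times> real \<Rightarrow> 'b" where
  "dz f x \<equiv> frechet_derivative f (at x) (1, 0)"

abbreviation dv :: "(real \<times> real \<Rightarrow> 'b::real_normed_vector) \<Rightarrow> real \<times> real \<Rightarrow> 'b" where
  "dv f x \<equiv> frechet_derivative f (at x) (0, 1)"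

lemma smooth_on_partial_derivative:
  assumes "smooth_on S f" "x \<in> S"
  shows "(f has_derivative (\<lambda>a. fst a *\<^sub>R dz f x + snd a *\<^sub>R dv f x)) (at x)"
proof -
  note f = smooth_on_has_derivative[OF assms]
  have "frechet_derivative f (at x) = (\<lambda>a. fst a *\<^sub>R dz f x + snd a *\<^sub>R dv f x)"
    by (rule ext, rule linear_plane[OF has_derivative_linear[OF f]])
  with f show ?thesis by simp
qed

lemma mink_has_vector_derivative:
  assumes "(f has_vector_derivative f') (at t)" "(g has_vector_derivative g') (at t)"
  shows "((\<lambda>t. mink (f t) (g t)) has_vector_derivative (mink (f t) g' + mink f' (g t))) (at t)"
proof -
  have "(\<lambda>h. mink (f t) (h *\<^sub>R g') + mink (h *\<^sub>R f') (g t)) = (\<lambda>h. h *\<^sub>R (mink (f t) g' + mink f' (g t)))"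
    by (simp add: mink_simps fun_eq_iff distrib_left)
  then show ?thesis
    using bounded_bilinear.FDERIV[OF bounded_bilinear_mink assms[unfolded has_vector_derivative_def]]
    unfolding has_vector_derivative_def by simp
qed

lemma mink_const_derivative:
  assumes "\<And>t. (f has_vector_derivative f' t) (at t)" "\<And>t. (g has_vector_derivative g' t) (at t)"
    and "\<And>t. mink (f t) (g t) = c"
  shows "mink (f t) (g' t) + mink (f' t) (g t) = 0"
proof -
  have "((\<lambda>t. c) has_vector_derivative (mink (f t) (g' t) + mink (f' t) (g t))) (at t)"
    using mink_has_vector_derivative[OF assms(1,2), of t] unfolding assms(3) .
  then show ?thesis using vector_derivative_unique_at[OF _ has_vector_derivative_const] by blast
qed

text \<open>A surface on the cylinder over the light cone is locally
  \<open>q(z, v) L(v) + z \<partial>\<^sub>4\<close> with a curve \<open>L\<close> of null vectors meeting the rulings of the cone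
  transversally. Its metric is \<open>dz\<^sup>2 + q\<^sup>2 dv\<^sup>2\<close> when \<open>L'\<close> is a unit vector. The curve is left
  open, so that a parabola can serve one direction of the theorem and a circle the other; the factor
  \<open>q\<close> may be negative, as it is on half of each model surface.\<close>

locale cone_chart = chart +
  fixes q :: "real \<times> real \<Rightarrow> real" and L L1 L2 :: "real \<Rightarrow> real ^ 4"
  assumes smooth_q: "smooth_on (\<sigma> ` U) q" and q_nonzero: "x \<in> \<sigma> ` U \<Longrightarrow> q x \<noteq> 0"
    and smooth_L: "smooth_on UNIV L"
    and L_L1: "(L has_vector_derivative L1 t) (at t)" and L1_L2: "(L1 has_vector_derivative L2 t) (at t)"
    and null_L: "mink (L t) (L t) = 0" and unit_L1: "mink (L1 t) (L1 t) = 1"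
    and L_4: "mink (L t) d4 = 0"
    and pos_eq: "p \<in> U \<Longrightarrow> pos M p = q (\<sigma> p) *\<^sub>R L (snd (\<sigma> p)) + fst (\<sigma> p) *\<^sub>R d4"
begin

definition \<rho> :: "real \<times> real \<Rightarrow> real" where "\<rho> x = dv q x / q x"

definition E1 :: "real \<times> real \<Rightarrow> real ^ 4" where "E1 x = dz q x *\<^sub>R L (snd x) + d4"

definition E2 :: "real \<times> real \<Rightarrow> real ^ 4" where "E2 x = \<rho> x *\<^sub>R L (snd x) + L1 (snd x)"

text \<open>All inner products of \<open>L\<close>, \<open>L'\<close>, \<open>L''\<close> and \<open>\<partial>\<^sub>4\<close> except \<open>\<langle>L'', L''\<rangle>\<close> follow by
  differentiating the normalization of \<open>L\<close>.\<close>

lemma L_products: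
  "mink (L t) (L1 t) = 0" "mink (L1 t) (L t) = 0" "mink (L t) (L2 t) = -1" "mink (L2 t) (L t) = -1"
  "mink (L1 t) (L2 t) = 0" "mink (L2 t) (L1 t) = 0" "mink (L1 t) d4 = 0" "mink (L2 t) d4 = 0"
  "mink d4 (L t) = 0" "mink d4 (L1 t) = 0" "mink d4 (L2 t) = 0" "mink d4 d4 = 1"
proof -
  have 0: "mink (L t) (L1 t) = 0" for t
    using mink_const_derivative[OF L_L1 L_L1 null_L, of t] mink_commute[of "L t" "L1 t"] by simp
  have "mink (L t) (L2 t) + mink (L1 t) (L1 t) = 0"
    by (rule mink_const_derivative[OF L_L1 L1_L2 0])
  then have 1: "mink (L t) (L2 t) = -1" using unit_L1[of t] by simp
  have 2: "mink (L1 t) (L2 t) = 0"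
    using mink_const_derivative[OF L1_L2 L1_L2 unit_L1, of t] mink_commute[of "L1 t" "L2 t"] by simp
  have d: "((\<lambda>t. d4) has_vector_derivative 0) (at t)" for t by (rule has_vector_derivative_const)
  have 3: "mink (L1 t) d4 = 0" for t
    using mink_const_derivative[OF L_L1 d L_4, of t] by (simp add: mink_simps)
  have 4: "mink (L2 t) d4 = 0"
    using mink_const_derivative[OF L1_L2 d 3, of t] by (simp add: mink_simps)
  show "mink (L t) (L1 t) = 0" "mink (L1 t) (L t) = 0" "mink (L t) (L2 t) = -1" "mink (L2 t) (L t) = -1"
    "mink (L1 t) (L2 t) = 0" "mink (L2 t) (L1 t) = 0" "mink (L1 t) d4 = 0" "mink (L2 t) d4 = 0"
    "mink d4 (L t) = 0" "mink d4 (L1 t) = 0" "mink d4 (L2 t) = 0"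
    using 0 1 2 3 4 L_4 by (simp_all add: mink_commute[of "L1 t" "L t"] mink_commute[of "L2 t" "L t"]
        mink_commute[of "L2 t" "L1 t"] mink_commute[of d4])
  show "mink d4 d4 = 1" by (simp add: mink_d4)
qed

lemma smooth_L1: "smooth_on UNIV L1"
proof (rule smooth_on_cong[OF open_UNIV])
  show "smooth_on UNIV (\<lambda>t. frechet_derivative L (at t) 1)" by (rule smooth_on_frechet_derivative[OF smooth_L])
  show "frechet_derivative L (at t) 1 = L1 t" for t
    using frechet_derivative_at[OF L_L1[unfolded has_vector_derivative_def], of t, symmetric] by simp
qed

lemma smooth_L2: "smooth_on UNIV L2"
proof (rule smooth_on_cong[OF open_UNIV])
  show "smooth_on UNIV (\<lambda>t. frechet_derivative L1 (at t) 1)" by (rule smooth_on_frechet_derivative[OF smooth_L1])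
  show "frechet_derivative L1 (at t) 1 = L2 t" for t
    using frechet_derivative_at[OF L1_L2[unfolded has_vector_derivative_def], of t, symmetric] by simp
qed

lemma smooth_snd:
  fixes f :: "real \<Rightarrow> real ^ 4"
  shows "smooth_on UNIV f \<Longrightarrow> smooth_on (\<sigma> ` U) (\<lambda>x. f (snd x))"
  by (rule smooth_on_compose[OF _ smooth_on_snd[OF open_image_U smooth_on_ident[OF open_image_U]]
        open_image_U open_UNIV]) simp_all

lemma smooth_\<rho>: "smooth_on (\<sigma> ` U) \<rho>"
  unfolding \<rho>_def
  by (intro smooth_on_divide smooth_on_frechet_derivative smooth_q open_image_U q_nonzero)

lemma scaleR_curve_has_derivative:
  assumes f: "smooth_on (\<sigma> ` U) f" and c: "\<And>t. (c has_vector_derivative c' t) (at t)" and p: "p \<in> U"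
  shows "((\<lambda>x. f x *\<^sub>R c (snd x)) has_derivative (\<lambda>a. f (\<sigma> p) *\<^sub>R snd a *\<^sub>R c' (snd (\<sigma> p)) +
      (fst a * dz f (\<sigma> p) + snd a * dv f (\<sigma> p)) *\<^sub>R c (snd (\<sigma> p)))) (at (\<sigma> p))"
proof -
  have f': "(f has_derivative (\<lambda>a. fst a * dz f (\<sigma> p) + snd a * dv f (\<sigma> p))) (at (\<sigma> p))"
    using smooth_on_partial_derivative[OF f, of "\<sigma> p"] p by simp
  have "((\<lambda>x. c (snd x)) has_derivative (\<lambda>a. snd a *\<^sub>R c' (snd (\<sigma> p)))) (at (\<sigma> p))"
    by (rule has_derivative_compose[OF has_derivative_snd[OF has_derivative_ident]
          c[unfolded has_vector_derivative_def]])
  from has_derivative_scaleR[OF f' this] show ?thesis .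
qed

lemma curve_has_derivative:
  assumes c: "\<And>t. (c has_vector_derivative c' t) (at t)"
  shows "((\<lambda>x. c (snd x)) has_derivative (\<lambda>a. snd a *\<^sub>R c' (snd x))) (at x)"
  by (rule has_derivative_compose[OF has_derivative_snd[OF has_derivative_ident]
        c[unfolded has_vector_derivative_def]])

lemma E1_has_derivative:
  assumes p: "p \<in> U"
  shows "(E1 has_derivative (\<lambda>a. dz q (\<sigma> p) *\<^sub>R snd a *\<^sub>R L1 (snd (\<sigma> p)) +
      (fst a * dz (dz q) (\<sigma> p) + snd a * dv (dz q) (\<sigma> p)) *\<^sub>R L (snd (\<sigma> p)))) (at (\<sigma> p))"
  using has_derivative_add[OF scaleR_curve_has_derivative[OF smooth_on_frechet_derivative[OF smooth_q] L_L1 p]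
      has_derivative_const[of d4]]
  unfolding E1_def by simp

lemma E2_has_derivative:
  assumes p: "p \<in> U"
  shows "(E2 has_derivative (\<lambda>a. (\<rho> (\<sigma> p) *\<^sub>R snd a *\<^sub>R L1 (snd (\<sigma> p)) +
      (fst a * dz \<rho> (\<sigma> p) + snd a * dv \<rho> (\<sigma> p)) *\<^sub>R L (snd (\<sigma> p))) +
      snd a *\<^sub>R L2 (snd (\<sigma> p)))) (at (\<sigma> p))"
  unfolding E2_def
  by (rule has_derivative_add[OF scaleR_curve_has_derivative[OF smooth_\<rho> L_L1 p] curve_has_derivative[OF L1_L2]])

lemma D_pos_cone:
  assumes p: "p \<in> U"
  shows "D (pos M) p a = fst a *\<^sub>R E1 (\<sigma> p) + (snd a * q (\<sigma> p)) *\<^sub>R E2 (\<sigma> p)"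
proof -
  let ?P = "\<lambda>x. q x *\<^sub>R L (snd x) + fst x *\<^sub>R d4"
  let ?D = "\<lambda>a. (q (\<sigma> p) *\<^sub>R snd a *\<^sub>R L1 (snd (\<sigma> p)) +
      (fst a * dz q (\<sigma> p) + snd a * dv q (\<sigma> p)) *\<^sub>R L (snd (\<sigma> p))) + fst a *\<^sub>R d4"
  have "(?P has_derivative ?D) (at (\<sigma> p))"
    by (intro has_derivative_add scaleR_curve_has_derivative[OF smooth_q L_L1 p]
        has_derivative_scaleR_left has_derivative_fst has_derivative_ident)
  then have "(rep (pos M) has_derivative ?D) (at (\<sigma> p))"
  proof (rule has_derivative_transform_within_open[OF _ open_image_U])
    show "\<sigma> p \<in> \<sigma> ` U" using p by blast
    show "?P x = rep (pos M) x" if "x \<in> \<sigma> ` U" for x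
      using that by (elim imageE) (simp add: rep_at pos_eq)
  qed
  then have "D (pos M) p = ?D" by (rule frechet_derivative_at[symmetric])
  moreover have "q (\<sigma> p) * \<rho> (\<sigma> p) = dv q (\<sigma> p)"
    unfolding \<rho>_def using q_nonzero[of "\<sigma> p"] p by simp
  ultimately show ?thesis
    unfolding E1_def E2_def by (simp add: scaleR_add_right scaleR_add_left mult.assoc)
qed

end

sublocale cone_chart \<subseteq> frame_chart M U \<sigma> E1 E2 q
proof
  show "smooth_on (\<sigma> ` U) E1" unfolding E1_def
    by (intro smooth_on_add smooth_on_scaleR smooth_on_frechet_derivative smooth_q smooth_snd smooth_L
        smooth_on_const open_image_U)
  show "smooth_on (\<sigma> ` U) E2" unfolding E2_def
    by (intro smooth_on_add smooth_on_scaleR smooth_\<rho> smooth_snd smooth_L smooth_L1 open_image_U)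
qed (simp_all add: E1_def E2_def mink_simps null_L unit_L1 L_4 L_products q_nonzero D_pos_cone[unfolded E1_def E2_def])

context cone_chart
begin

text \<open>The coordinate expression of the mean curvature vector. Its summand \<open>q\<^sub>z E\<^sub>1\<close> cancels the
  tangential part of \<open>L''\<close>, which is \<open>- q\<^sub>z E\<^sub>1 - \<rho> E\<^sub>2\<close> and whose second half is cancelled by
  \<open>\<rho> L'\<close>.\<close>

definition H :: "real \<times> real \<Rightarrow> real ^ 4" where
  "H x = (1 / 2) *\<^sub>R (dz (dz q) x *\<^sub>R L (snd x) +
     (1 / q x) *\<^sub>R (dv \<rho> x *\<^sub>R L (snd x) + \<rho> x *\<^sub>R L1 (snd x) + L2 (snd x) + dz q x *\<^sub>R E1 x))"

lemma DE1_cone: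
  assumes "p \<in> U"
  shows "DE1 (\<sigma> p) a = (dz q (\<sigma> p) * snd a) *\<^sub>R L1 (snd (\<sigma> p)) +
      (fst a * dz (dz q) (\<sigma> p) + snd a * dv (dz q) (\<sigma> p)) *\<^sub>R L (snd (\<sigma> p))"
  using frechet_derivative_at[OF E1_has_derivative[OF assms], symmetric] by simp

lemma DE2_cone:
  assumes "p \<in> U"
  shows "DE2 (\<sigma> p) a = (\<rho> (\<sigma> p) * snd a) *\<^sub>R L1 (snd (\<sigma> p)) +
      (fst a * dz \<rho> (\<sigma> p) + snd a * dv \<rho> (\<sigma> p)) *\<^sub>R L (snd (\<sigma> p)) + snd a *\<^sub>R L2 (snd (\<sigma> p))"
  using frechet_derivative_at[OF E2_has_derivative[OF assms], symmetric] by simp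

lemma mink_frame:
  "mink (L (snd x)) (E1 x) = 0" "mink (L1 (snd x)) (E1 x) = 0" "mink (L2 (snd x)) (E1 x) = - dz q x"
  "mink (L (snd x)) (E2 x) = 0" "mink (L1 (snd x)) (E2 x) = 1" "mink (L2 (snd x)) (E2 x) = - \<rho> x"
  unfolding E1_def E2_def by (simp_all add: mink_simps null_L unit_L1 L_4 L_products)

lemma mean_curv_cone:
  assumes p: "p \<in> U"
  shows "mean_curv M p = H (\<sigma> p)"
  unfolding mean_curv_frame[OF p] H_def nor_def DE1_cone[OF p] DE2_cone[OF p]
  by (simp add: mink_simps mink_frame scaleR_add_right)

lemma smooth_H: "smooth_on (\<sigma> ` U) H"
  unfolding H_def
  by (intro smooth_on_add smooth_on_scaleR smooth_on_frechet_derivative smooth_on_divide smooth_q smooth_\<rho>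
      smooth_snd smooth_L smooth_L1 smooth_L2 smooth_on_const open_image_U q_nonzero smooth_E1)

lemma mink_H:
  "mink (H x) (L (snd x)) = - 1 / (2 * q x)"
  "mink (H x) (L1 (snd x)) = \<rho> x / (2 * q x)"
  "mink (H x) (L2 (snd x)) = (- dz (dz q) x + (mink (L2 (snd x)) (L2 (snd x)) - dv \<rho> x - (dz q x)\<^sup>2) / q x) / 2"
  unfolding H_def E1_def
  by (simp_all add: mink_simps null_L unit_L1 L_4 L_products power2_eq_square)

lemma H_normal:
  assumes "x \<in> \<sigma> ` U"
  shows "mink (H x) (E1 x) = 0" "mink (H x) (E2 x) = 0"
  using q_nonzero[OF assms] E1_E1[OF assms] E1_E2[OF assms]
  unfolding H_def by (simp_all add: mink_simps mink_frame)

lemma shape_op_cone: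
  assumes p: "p \<in> U"
  defines "x \<equiv> \<sigma> p"
  shows "mink (shape_op M (mean_curv M) p (a *\<^sub>R E1 x + b *\<^sub>R E2 x)) (c *\<^sub>R E1 x + d *\<^sub>R E2 x) =
    a * c * (- dz (dz q) x / (2 * q x)) + b * c * ((\<rho> x * dz q x - dv (dz q) x) / (2 * (q x)\<^sup>2)) +
    a * d * (- dz \<rho> x / (2 * q x)) +
    b * d * (- dz (dz q) x / (2 * q x) +
      ((\<rho> x)\<^sup>2 + mink (L2 (snd x)) (L2 (snd x)) - (dz q x)\<^sup>2 - 2 * dv \<rho> x) / (2 * (q x)\<^sup>2))"
proof -
  have x: "x \<in> \<sigma> ` U" using p unfolding x_def by blast
  have q: "q x \<noteq> 0" by (rule q_nonzero[OF x])
  have "mink (shape_op M (mean_curv M) p (a *\<^sub>R E1 x + b *\<^sub>R E2 x)) (c *\<^sub>R E1 x + d *\<^sub>R E2 x) =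
      mink (H x) (c *\<^sub>R DE1 x (a, b / q x) + d *\<^sub>R DE2 x (a, b / q x))"
    unfolding x_def
    by (rule shape_op_frame[OF p mean_curv_cone smooth_on_has_derivative[OF smooth_H] H_normal])
      (use p in auto)
  then show ?thesis
    unfolding DE1_cone[OF p, folded x_def] DE2_cone[OF p, folded x_def]
    using q by (simp add: mink_simps mink_H) (simp add: field_simps power2_eq_square)
qed

text \<open>In the orthonormal frame, \<open>A\<^sub>H = f id\<close> is four scalar equations. The off-diagonal entry
  appears twice, as \<open>\<langle>H, DE\<^sub>2(E\<^sub>1)\<rangle>\<close> and as \<open>\<langle>H, DE\<^sub>1(E\<^sub>2)\<rangle>\<close>, which gives
  \<open>\<rho>\<^sub>z = 0\<close> and \<open>(q\<^sub>z)\<^sub>v = \<rho> q\<^sub>z\<close>. The two diagonal entries both contain \<open>- q\<^sub>z\<^sub>z / (2 q)\<close>, which leaves the last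
  equation as their difference.\<close>

lemma pseudo_umbilical_at_iff:
  assumes p: "p \<in> U"
  defines "x \<equiv> \<sigma> p"
  shows "(\<forall>v \<in> tangent_space M p. \<forall>w \<in> tangent_space M p.
        mink (shape_op M (mean_curv M) p v) w = f * mink v w) \<longleftrightarrow>
    f = - dz (dz q) x / (2 * q x) \<and> dz \<rho> x = 0 \<and> dv (dz q) x = \<rho> x * dz q x \<and>
    2 * dv \<rho> x = (\<rho> x)\<^sup>2 + mink (L2 (snd x)) (L2 (snd x)) - (dz q x)\<^sup>2" (is "?P \<longleftrightarrow> ?Q")
proof
  have q: "q x \<noteq> 0" using q_nonzero p unfolding x_def by blast
  note fr = frame_simps[OF p, folded x_def]
  note sh = shape_op_cone[OF p, folded x_def]
  {
    assume P: ?P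
    have e: "E1 x \<in> tangent_space M p" "E2 x \<in> tangent_space M p"
      using E1_tangent[OF p] E2_tangent[OF p] unfolding x_def by blast+
    have "- dz (dz q) x / (2 * q x) = f"
      using P e(1) sh[of 1 0 1 0] fr by fastforce
    moreover have "(\<rho> x * dz q x - dv (dz q) x) / (2 * (q x)\<^sup>2) = 0"
      using P e sh[of 0 1 1 0] fr by fastforce
    moreover have "- dz \<rho> x / (2 * q x) = 0"
      using P e sh[of 1 0 0 1] fr by fastforce
    moreover have "- dz (dz q) x / (2 * q x) +
      ((\<rho> x)\<^sup>2 + mink (L2 (snd x)) (L2 (snd x)) - (dz q x)\<^sup>2 - 2 * dv \<rho> x) / (2 * (q x)\<^sup>2) = f"
      using P e(2) sh[of 0 1 0 1] fr by fastforce
    ultimately show ?Q using q by auto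
  }
  {
    assume Q: ?Q
    show ?P
    proof (intro ballI)
      fix v w assume "v \<in> tangent_space M p" "w \<in> tangent_space M p"
      then obtain a b c d where "v = a *\<^sub>R E1 x + b *\<^sub>R E2 x" "w = c *\<^sub>R E1 x + d *\<^sub>R E2 x"
        using tangent_space_frame[OF p, folded x_def] by blast
      then have "mink v w = a * c + b * d"
        and "mink (shape_op M (mean_curv M) p v) w =
          mink (shape_op M (mean_curv M) p (a *\<^sub>R E1 x + b *\<^sub>R E2 x)) (c *\<^sub>R E1 x + d *\<^sub>R E2 x)"
        using fr by (simp_all add: mink_simps)
      moreover have "\<rho> x * dz q x - dv (dz q) x = 0" "dz \<rho> x = 0" "- dz (dz q) x / (2 * q x) = f"
        "(\<rho> x)\<^sup>2 + mink (L2 (snd x)) (L2 (snd x)) - (dz q x)\<^sup>2 - 2 * dv \<rho> x = 0"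
        using Q by simp_all
      ultimately show "mink (shape_op M (mean_curv M) p v) w = f * mink v w"
        unfolding sh by (simp only:) (simp add: algebra_simps)
    qed
  }
qed

lemma theta_cone:
  assumes p: "p \<in> U"
  shows "theta M p = q (\<sigma> p) *\<^sub>R L (snd (\<sigma> p))"
proof -
  have "L t $ 4 = 0" for t using L_4[of t] by (simp add: mink_d4)
  then show ?thesis
    unfolding theta_def pos_eq[OF p] by (simp add: vec_eq_iff forall_4 axis_def vector_4)
qed

text \<open>Here \<open>\<partial>\<^sub>4\<close> has tangential part \<open>E\<^sub>1 = \<partial>\<^sub>z\<close>, and \<open>\<theta> = q L\<close> changes along it by
  \<open>q\<^sub>z L\<close>, a multiple of \<open>\<theta>\<close>.\<close>

lemma alpha_cone:
  assumes p: "p \<in> U"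
  shows "alpha M p = dz q (\<sigma> p) / q (\<sigma> p)"
proof -
  let ?x = "\<sigma> p"
  have q: "q ?x \<noteq> 0" using q_nonzero p by blast
  have "L (snd ?x) \<noteq> 0"
    using L_products(3)[of "snd ?x"] by (metis mink_zero_left zero_neq_neg_one)
  then have theta0: "theta M p \<noteq> 0" using q by (simp add: theta_cone[OF p])
  have "tan_part M p d4 = 1 *\<^sub>R E1 ?x + 0 *\<^sub>R E2 ?x"
    unfolding tan_part_frame[OF p] by (simp add: E1_def E2_def mink_simps L_products)
  then have "normal_conn M p (tan_part M p d4) (theta M) = nor ?x (dz q ?x *\<^sub>R L (snd ?x))"
    unfolding normal_conn_def nor_part_frame[OF p]
    using flat_deriv_frame[OF p theta_cone scaleR_curve_has_derivative[OF smooth_q L_L1 p], of 1 0] by simp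
  also have "\<dots> = (dz q ?x / q ?x) *\<^sub>R theta M p"
    using q by (simp add: nor_def mink_simps mink_frame theta_cone[OF p])
  finally show ?thesis
    unfolding alpha_def using theta0 by simp
qed

end

section \<open>Isometries and the model surface\<close>

lemma mink_3: "mink u v = - (u $ 1 * v $ 1) + u $ 2 * v $ 2 + u $ 3 * v $ 3" for u v :: "real ^ 3"
  by (simp add: mink_inner inner_vec_def sum_3)

lemma mink_4: "mink u v = - (u $ 1 * v $ 1) + u $ 2 * v $ 2 + u $ 3 * v $ 3 + u $ 4 * v $ 4"
  for u v :: "real ^ 4"
  by (simp add: mink_inner inner_vec_def sum_4)

definition proj3 :: "real ^ 4 \<Rightarrow> real ^ 3" where
  "proj3 x = vector [x $ 1, x $ 2, x $ 3]"

definition emb4 :: "real ^ 3 \<Rightarrow> real ^ 4" where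
  "emb4 y = vector [y $ 1, y $ 2, y $ 3, 0]"

lemma proj3_nth [simp]: "proj3 x $ 1 = x $ 1" "proj3 x $ 2 = x $ 2" "proj3 x $ 3 = x $ 3"
  by (simp_all add: proj3_def)

lemma emb4_nth [simp]: "emb4 y $ 1 = y $ 1" "emb4 y $ 2 = y $ 2" "emb4 y $ 3 = y $ 3" "emb4 y $ 4 = 0"
  by (simp_all add: emb4_def vector_4)

lemma linear_proj3: "linear proj3"
  by (rule linearI) (simp_all add: vec_eq_iff forall_3)

lemma linear_emb4: "linear emb4"
  by (rule linearI) (simp_all add: vec_eq_iff forall_4)

lemma bounded_linear_proj3: "bounded_linear proj3"
  using linear_proj3 linear_conv_bounded_linear by blast

lemma bounded_linear_emb4: "bounded_linear emb4"
  using linear_emb4 linear_conv_bounded_linear by blast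

lemma mink_emb4: "mink (emb4 u) (emb4 v) = mink u v"
  by (simp add: mink_3 mink_4)

lemma emb4_proj3: "emb4 (proj3 x) + x $ 4 *\<^sub>R d4 = x"
  by (simp add: vec_eq_iff forall_4 axis_def)

lemma proj3_emb4: "proj3 (emb4 y + s *\<^sub>R d4) = y"
  by (simp add: vec_eq_iff forall_3 axis_def)

lemma hyperplane_isometryD:
  assumes "hyperplane_isometry Q"
  obtains R :: "real ^ 3 \<Rightarrow> real ^ 3" where "linear R" "\<And>u v. mink (R u) (R v) = mink u v"
    "\<And>x. Q x = emb4 (R (proj3 x)) + x $ 4 *\<^sub>R d4"
proof -
  obtain R :: "real ^ 3 \<Rightarrow> real ^ 3" where R: "linear R" "\<forall>u v. mink (R u) (R v) = mink u v"
    and Q: "\<forall>x. Q x = (let y = R (vector [x $ 1, x $ 2, x $ 3]) in vector [y $ 1, y $ 2, y $ 3, x $ 4])"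
    using assms unfolding hyperplane_isometry_def by (elim exE conjE) (rule that)
  have "Q x = emb4 (R (proj3 x)) + x $ 4 *\<^sub>R d4" for x
    using Q[THEN spec, of x]
    by (simp add: Let_def proj3_def vec_eq_iff forall_4 vector_4 axis_def)
  with R show ?thesis using that by blast
qed

lemma hyperplane_isometryI:
  fixes R :: "real ^ 3 \<Rightarrow> real ^ 3"
  assumes "linear R" "\<And>u v. mink (R u) (R v) = mink u v"
  shows "hyperplane_isometry (\<lambda>x. emb4 (R (proj3 x)) + x $ 4 *\<^sub>R d4)"
  unfolding hyperplane_isometry_def
proof (intro exI[of _ R] conjI allI)
  show "emb4 (R (proj3 x)) + x $ 4 *\<^sub>R d4 =
    (let y = R (vector [x $ 1, x $ 2, x $ 3]) in vector [y $ 1, y $ 2, y $ 3, x $ 4])" for x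
    by (simp add: Let_def proj3_def[symmetric] vec_eq_iff forall_4 vector_4 axis_def)
qed (use assms in auto)

text \<open>The model surface is the part of the cylinder over both nappes of the cone cut out by
  \<open>\<langle>W\<^sub>0, x\<rangle> = x\<^sub>4 + c\<close>. The unit timelike vector \<open>W\<^sub>0\<close> is completed to an orthonormal basis so that \<open>t\<close> is the angle in the plane
  orthogonal to \<open>W\<^sub>0\<close>: on the cone, a vector with \<open>W\<^sub>0\<close>-product \<open>1\<close> is \<open>- W\<^sub>0\<close> plus a unit
  vector of that plane.\<close>

definition W\<^sub>0 :: "real ^ 3" where "W\<^sub>0 = vector [- 3 / (2 * sqrt 2), 0, 1 / (2 * sqrt 2)]"
definition X\<^sub>0 :: "real ^ 3" where "X\<^sub>0 = vector [- 1 / (2 * sqrt 2), 0, 3 / (2 * sqrt 2)]"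
definition Y\<^sub>0 :: "real ^ 3" where "Y\<^sub>0 = vector [0, 1, 0]"

lemma model_frame:
  "mink W\<^sub>0 W\<^sub>0 = -1" "mink X\<^sub>0 X\<^sub>0 = 1" "mink Y\<^sub>0 Y\<^sub>0 = 1" "mink W\<^sub>0 X\<^sub>0 = 0" "mink W\<^sub>0 Y\<^sub>0 = 0" "mink X\<^sub>0 Y\<^sub>0 = 0"
  "mink X\<^sub>0 W\<^sub>0 = 0" "mink Y\<^sub>0 W\<^sub>0 = 0" "mink Y\<^sub>0 X\<^sub>0 = 0"
  unfolding W\<^sub>0_def X\<^sub>0_def Y\<^sub>0_def mink_3 by (simp_all add: field_simps)

lemma mink_model_frame:
  "mink x y = - (mink x W\<^sub>0 * mink y W\<^sub>0) + mink x X\<^sub>0 * mink y X\<^sub>0 + mink x Y\<^sub>0 * mink y Y\<^sub>0"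
  unfolding W\<^sub>0_def X\<^sub>0_def Y\<^sub>0_def mink_3 by (simp add: field_simps)

definition model_circle :: "real \<Rightarrow> real ^ 3" where
  "model_circle t = cos t *\<^sub>R X\<^sub>0 + sin t *\<^sub>R Y\<^sub>0 - W\<^sub>0"

lemma model_eq: "model c x = emb4 ((fst x + c) *\<^sub>R model_circle (snd x)) + fst x *\<^sub>R d4"
  unfolding model_def model_circle_def W\<^sub>0_def X\<^sub>0_def Y\<^sub>0_def
  by (cases x) (simp add: vec_eq_iff forall_4 vector_4 axis_def field_simps)

text \<open>The cross product for the Minkowski form: \<open>\<langle>u \<times> v, x\<rangle>\<close> is the determinant of \<open>u, v, x\<close>.\<close>

definition lorentz_cross :: "real ^ 3 \<Rightarrow> real ^ 3 \<Rightarrow> real ^ 3" where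
  "lorentz_cross u v = vector [- (u $ 2 * v $ 3 - u $ 3 * v $ 2), u $ 3 * v $ 1 - u $ 1 * v $ 3, u $ 1 * v $ 2 - u $ 2 * v $ 1]"

text \<open>The expansion of \<open>x\<close> is the Minkowski form of the double cross product identity, specialized
  to orthonormal \<open>W\<close> and \<open>X\<close>.\<close>

lemma lorentz_frame:
  fixes W X :: "real ^ 3"
  assumes "mink W W = -1" "mink X X = 1" "mink W X = 0"
  defines "Y \<equiv> lorentz_cross W X"
  shows "mink Y Y = 1" "mink Y W = 0" "mink Y X = 0"
    and "x = - mink x W *\<^sub>R W + mink x X *\<^sub>R X + mink x Y *\<^sub>R Y"
proof -
  have YY: "mink Y Y = (mink W X)\<^sup>2 - mink W W * mink X X"
    unfolding Y_def lorentz_cross_def mink_3 by (simp add: algebra_simps power2_eq_square)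
  then show "mink Y Y = 1" using assms by simp
  show "mink Y W = 0" "mink Y X = 0"
    unfolding Y_def lorentz_cross_def mink_3 by (simp_all add: algebra_simps)
  have "mink x Y *\<^sub>R Y = - ((mink W W * mink X X - (mink W X)\<^sup>2) *\<^sub>R x +
      (mink W X * mink X x - mink W x * mink X X) *\<^sub>R W + (mink W X * mink W x - mink W W * mink X x) *\<^sub>R X)"
    unfolding Y_def lorentz_cross_def mink_3 vec_eq_iff forall_3
    by (simp add: algebra_simps power2_eq_square)
  then show "x = - mink x W *\<^sub>R W + mink x X *\<^sub>R X + mink x Y *\<^sub>R Y"
    using assms by (simp add: mink_commute[of x])
qed

lemma frame_isometry:
  fixes W X Y :: "real ^ 3"
  assumes "mink W W = -1" "mink X X = 1" "mink W X = 0" "mink Y Y = 1" "mink Y W = 0" "mink Y X = 0"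
  defines "R \<equiv> \<lambda>x. - mink x W\<^sub>0 *\<^sub>R W + mink x X\<^sub>0 *\<^sub>R X + mink x Y\<^sub>0 *\<^sub>R Y"
  shows "linear R" "mink (R u) (R v) = mink u v" "R (model_circle t) = cos t *\<^sub>R X + sin t *\<^sub>R Y - W"
proof -
  show "linear R" unfolding R_def
    by (rule linearI) (simp_all add: mink_simps algebra_simps)
  show "mink (R u) (R v) = mink u v"
    unfolding R_def mink_model_frame[of u v] using assms(1-6) mink_commute[of X W] mink_commute[of W Y] mink_commute[of X Y]
    by (simp add: mink_simps)
  show "R (model_circle t) = cos t *\<^sub>R X + sin t *\<^sub>R Y - W"
    unfolding R_def model_circle_def by (simp add: mink_simps model_frame)
qed

lemma model_isometry_circle:
  fixes R :: "real ^ 3 \<Rightarrow> real ^ 3"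
  assumes "linear R"
  defines "L \<equiv> \<lambda>t. emb4 (R (model_circle t))"
    and "L1 \<equiv> \<lambda>t. emb4 (R (cos t *\<^sub>R Y\<^sub>0 - sin t *\<^sub>R X\<^sub>0))"
    and "L2 \<equiv> \<lambda>t. emb4 (R (- cos t *\<^sub>R X\<^sub>0 - sin t *\<^sub>R Y\<^sub>0))"
  shows "smooth_on UNIV L" "(L has_vector_derivative L1 t) (at t)" "(L1 has_vector_derivative L2 t) (at t)"
proof -
  have bl: "bounded_linear (\<lambda>y. emb4 (R y))"
    using bounded_linear_compose[OF bounded_linear_emb4] linear_conv_bounded_linear assms(1) by blast
  have "smooth_on UNIV model_circle" unfolding model_circle_def
    by (intro smooth_on_diff smooth_on_add smooth_on_scaleR smooth_on_const smooth_on_sin smooth_on_cos open_UNIV)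
  then show "smooth_on UNIV L"
    unfolding L_def by (rule smooth_on_bounded_linear_comp[OF bl open_UNIV])
  have "(model_circle has_vector_derivative (cos t *\<^sub>R Y\<^sub>0 - sin t *\<^sub>R X\<^sub>0)) (at t)"
    unfolding model_circle_def has_vector_derivative_def
    by (auto intro!: derivative_eq_intros simp: scaleR_diff_right fun_eq_iff algebra_simps)
  then show "(L has_vector_derivative L1 t) (at t)"
    unfolding L_def L1_def by (rule bounded_linear.has_vector_derivative[OF bl])
  have "((\<lambda>t. cos t *\<^sub>R Y\<^sub>0 - sin t *\<^sub>R X\<^sub>0) has_vector_derivative (- cos t *\<^sub>R X\<^sub>0 - sin t *\<^sub>R Y\<^sub>0)) (at t)"
    unfolding has_vector_derivative_def
    by (auto intro!: derivative_eq_intros simp: scaleR_diff_right fun_eq_iff algebra_simps)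
  then show "(L1 has_vector_derivative L2 t) (at t)"
    unfolding L1_def L2_def by (rule bounded_linear.has_vector_derivative[OF bl])
qed

context riemannian
begin

text \<open>Here \<open>L\<close> is the isometric image of the circle, \<open>q = s + c\<close>, \<open>\<rho> = 0\<close>, \<open>q\<^sub>z = 1\<close> and
  \<open>\<langle>L'', L''\<rangle> = 1\<close>, so that the equations for pseudo-umbilicity hold with \<open>f = 0\<close>. The cone
  condition is what keeps \<open>q\<close> away from \<open>0\<close>.\<close>

lemma shape_op_model_eq_0:
  assumes chart: "smooth_chart M (U, \<sigma>)" and Q: "hyperplane_isometry Q"
    and pos: "\<And>p. p \<in> U \<Longrightarrow> pos M p = Q (model c (\<sigma> p))" and cone: "pos M ` U \<subseteq> cone_cylinder"
    and p: "p \<in> U" and vw: "v \<in> tangent_space M p" "w \<in> tangent_space M p"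
  shows "mink (shape_op M (mean_curv M) p v) w = 0"
proof -
  obtain R :: "real ^ 3 \<Rightarrow> real ^ 3" where R: "linear R" "\<And>u v. mink (R u) (R v) = mink u v"
    and Q: "\<And>x. Q x = emb4 (R (proj3 x)) + x $ 4 *\<^sub>R d4" using hyperplane_isometryD[OF Q] by blast
  define L where "L = (\<lambda>t. emb4 (R (model_circle t)))"
  define L1 where "L1 = (\<lambda>t. emb4 (R (cos t *\<^sub>R Y\<^sub>0 - sin t *\<^sub>R X\<^sub>0)))"
  define L2 where "L2 = (\<lambda>t. emb4 (R (- cos t *\<^sub>R X\<^sub>0 - sin t *\<^sub>R Y\<^sub>0)))"
  define q where "q = (\<lambda>x :: real \<times> real. fst x + c)"
  have pos_eq: "pos M r = q (\<sigma> r) *\<^sub>R L (snd (\<sigma> r)) + fst (\<sigma> r) *\<^sub>R d4" if "r \<in> U" for r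
  proof -
    have "model c (\<sigma> r) $ 4 = fst (\<sigma> r)" unfolding model_eq by (simp add: axis_def)
    then show ?thesis
      unfolding pos[OF that] Q model_eq proj3_emb4 q_def L_def
      by (simp add: linear_scale[OF R(1)] linear_scale[OF linear_emb4] axis_def)
  qed
  have sc: "(sin t)\<^sup>2 + (cos t)\<^sup>2 = 1" for t :: real by simp
  interpret chart M U \<sigma> using chart by unfold_locales
  interpret cone_chart M U \<sigma> q L L1 L2
  proof
    show "smooth_on (\<sigma> ` U) q" unfolding q_def
      by (intro smooth_on_add smooth_on_fst smooth_on_ident smooth_on_const open_image_U)
    show "q x \<noteq> 0" if "x \<in> \<sigma> ` U" for x
    proof
      assume "q x = 0"
      moreover obtain r where r: "r \<in> U" "x = \<sigma> r" using \<open>x \<in> \<sigma> ` U\<close> by blast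
      ultimately have "pos M r $ 1 = 0" using pos_eq[OF r(1)] by (simp add: axis_def)
      moreover have "pos M r \<in> cone_cylinder" using cone r(1) by blast
      ultimately show False unfolding cone_cylinder_def by simp
    qed
    show "smooth_on UNIV L" "(L has_vector_derivative L1 t) (at t)" "(L1 has_vector_derivative L2 t) (at t)" for t
      unfolding L_def L1_def L2_def by (rule model_isometry_circle[OF R(1)])+
    show "mink (L t) (L t) = 0" "mink (L1 t) (L1 t) = 1" for t
      unfolding L_def L1_def mink_emb4 R(2) model_circle_def
      using sc[of t] by (simp_all add: mink_simps model_frame power2_eq_square algebra_simps)
    show "mink (L t) d4 = 0" for t unfolding L_def mink_d4 by simp
  qed (rule pos_eq)
  have "(q has_derivative fst) (at x)" for x unfolding q_def
    by (auto intro!: derivative_eq_intros)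
  then have dq: "frechet_derivative q (at x) = fst" for x by (rule frechet_derivative_at[symmetric])
  then have rho: "\<rho> = (\<lambda>x. 0)" by (simp add: \<rho>_def fun_eq_iff)
  have "mink (L2 t) (L2 t) = 1" for t
    unfolding L2_def mink_emb4 R(2) using sc[of t]
    by (simp add: mink_simps model_frame power2_eq_square algebra_simps)
  then have "\<forall>v \<in> tangent_space M p. \<forall>w \<in> tangent_space M p.
      mink (shape_op M (mean_curv M) p v) w = 0 * mink v w"
    unfolding pseudo_umbilical_at_iff[OF p] by (simp add: rho dq)
  with vw show ?thesis by simp
qed

lemma pseudo_umbilical_if_model:
  assumes cone: "pos M ` points M \<subseteq> cone_cylinder"
    and model: "\<forall>p \<in> points M. \<exists>U. openin (topol M) U \<and> p \<in> U \<and> (\<exists>c. congruent_to M U (model c))"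
  shows "pseudo_umbilical M"
proof -
  have "mink (shape_op M (mean_curv M) p v) w = 0 * mink v w"
    if p: "p \<in> points M" and "v \<in> tangent_space M p" "w \<in> tangent_space M p" for p v w
  proof -
    obtain U c where U: "openin (topol M) U" "p \<in> U" and "congruent_to M U (model c)"
      using model p by blast
    then obtain Q \<sigma> where Q: "hyperplane_isometry Q" "smooth_chart M (U, \<sigma>)"
      "\<And>p. p \<in> U \<Longrightarrow> pos M p = Q (model c (\<sigma> p))"
      unfolding congruent_to_def by (elim exE conjE) (rule that, auto)
    have "pos M ` U \<subseteq> cone_cylinder" using cone openin_subset[OF U(1)] by blast
    from shape_op_model_eq_0[OF Q(2,1,3) this U(2)] that show ?thesis by simp
  qed
  moreover have "smooth_map M (points M) (\<lambda>_. 0 :: real)"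
    unfolding smooth_map_def
  proof
    fix c assume "c \<in> atlas M"
    then have "top_chart (topol M) c" using atlas_smooth_chart smooth_chart_top_chart by blast
    from top_chart_open_image[OF this openin_topspace]
    have "smooth_on (snd c ` (fst c \<inter> points M)) (\<lambda>x. 0 :: real)" by (rule smooth_on_const)
    then show "smooth_on (snd c ` (fst c \<inter> points M)) (local_rep c (\<lambda>_. 0 :: real))"
      by (simp add: local_rep_def comp_def)
  qed
  ultimately show ?thesis
    unfolding pseudo_umbilical_def by (intro exI[of _ "\<lambda>_. 0 :: real"]) simp
qed

end

section \<open>Null coordinates on the cone\<close>

text \<open>A parabola of null vectors that meets every ruling of the light cone but one. Unlike the circle
  it has \<open>\<langle>L'', L''\<rangle> = 0\<close>, which turns the equation for \<open>1 / q\<^sub>z\<close> into the vanishing of a third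
  derivative.\<close>

definition parabola :: "real \<Rightarrow> real \<Rightarrow> real ^ 3" where
  "parabola \<epsilon> t = vector [(1 + t\<^sup>2) / 2, \<epsilon> * (1 - t\<^sup>2) / 2, t]"

lemma parabola_nth [simp]:
  "parabola \<epsilon> t $ 1 = (1 + t\<^sup>2) / 2" "parabola \<epsilon> t $ 2 = \<epsilon> * (1 - t\<^sup>2) / 2" "parabola \<epsilon> t $ 3 = t"
  by (simp_all add: parabola_def)

lemma parabola_curve:
  assumes "\<epsilon>\<^sup>2 = (1 :: real)"
  defines "L \<equiv> \<lambda>t. emb4 (parabola \<epsilon> t)"
    and "L1 \<equiv> \<lambda>t. emb4 (vector [t, - \<epsilon> * t, 1])" and "L2 \<equiv> \<lambda>t :: real. emb4 (vector [1, - \<epsilon>, 0])"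
  shows "smooth_on UNIV L" "(L has_vector_derivative L1 t) (at t)" "(L1 has_vector_derivative L2 t) (at t)"
    "mink (L t) (L t) = 0" "mink (L1 t) (L1 t) = 1" "mink (L t) d4 = 0" "mink (L2 t) (L2 t) = 0"
proof -
  have L: "L = (\<lambda>t. emb4 (vector [1 / 2, \<epsilon> / 2, 0]) + t *\<^sub>R emb4 (vector [0, 0, 1]) +
      (t * t) *\<^sub>R emb4 (vector [1 / 2, - \<epsilon> / 2, 0]))"
    unfolding L_def by (simp add: fun_eq_iff vec_eq_iff forall_4 power2_eq_square field_simps)
  show "smooth_on UNIV L" unfolding L
    by (intro smooth_on_add smooth_on_scaleR smooth_on_mult smooth_on_ident smooth_on_const open_UNIV)
  have "(L has_vector_derivative (emb4 (vector [0, 0, 1]) + (t + t) *\<^sub>R emb4 (vector [1 / 2, - \<epsilon> / 2, 0]))) (at t)"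
    unfolding L has_vector_derivative_def
    by (auto intro!: derivative_eq_intros simp: fun_eq_iff algebra_simps)
  moreover have "emb4 (vector [0, 0, 1]) + (t + t) *\<^sub>R emb4 (vector [1 / 2, - \<epsilon> / 2, 0]) = L1 t"
    unfolding L1_def by (simp add: vec_eq_iff forall_4)
  ultimately show "(L has_vector_derivative L1 t) (at t)" by simp
  have L1: "L1 = (\<lambda>t. emb4 (vector [0, 0, 1]) + t *\<^sub>R L2 0)"
    unfolding L1_def L2_def by (simp add: fun_eq_iff vec_eq_iff forall_4)
  have "L2 t = L2 0" unfolding L2_def by simp
  then show "(L1 has_vector_derivative L2 t) (at t)"
    unfolding L1 has_vector_derivative_def by (auto intro!: derivative_eq_intros)
  have e: "\<epsilon> * \<epsilon> = 1" using assms(1) by (simp add: power2_eq_square)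
  then have e': "\<epsilon> * (\<epsilon> * a) = a" for a by (metis mult.assoc mult_1)
  show "mink (L t) (L t) = 0" "mink (L1 t) (L1 t) = 1" "mink (L2 t) (L2 t) = 0"
    unfolding L_def L1_def L2_def mink_emb4 mink_3
    using e by (simp_all add: field_simps power2_eq_square e')
  show "mink (L t) d4 = 0" unfolding L_def mink_d4 by simp
qed

text \<open>On the cone \<open>(x\<^sub>1 - \<epsilon> x\<^sub>2) q = x\<^sub>3\<^sup>2\<close>, so that \<open>q\<close> and \<open>x\<^sub>3\<close> determine a point off the
  ray \<open>q = 0\<close>.\<close>

lemma cone_point:
  assumes x: "x \<in> cone_cylinder" and "\<epsilon>\<^sup>2 = 1" and pos: "x $ 1 + \<epsilon> * x $ 2 > 0"
  defines "q \<equiv> x $ 1 + \<epsilon> * x $ 2"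
  shows "x = q *\<^sub>R emb4 (parabola \<epsilon> (x $ 3 / q)) + x $ 4 *\<^sub>R d4"
proof -
  have q: "q \<noteq> 0" using pos unfolding q_def by simp
  have e: "\<epsilon> * \<epsilon> = 1" using assms(2) by (simp add: power2_eq_square)
  have x3: "(x $ 3)\<^sup>2 = (x $ 1 - \<epsilon> * x $ 2) * q"
    using x e unfolding cone_cylinder_def q_def by (simp add: power2_eq_square) algebra
  then have t: "q * (x $ 3 / q)\<^sup>2 = x $ 1 - \<epsilon> * x $ 2"
    using q by (simp add: power_divide power2_eq_square)
  have "q * ((1 + (x $ 3 / q)\<^sup>2) / 2) = (q + q * (x $ 3 / q)\<^sup>2) / 2"
    "q * (\<epsilon> * (1 - (x $ 3 / q)\<^sup>2) / 2) = \<epsilon> * (q - q * (x $ 3 / q)\<^sup>2) / 2"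
    by (simp_all add: field_simps)
  then have "q * ((1 + (x $ 3 / q)\<^sup>2) / 2) = x $ 1" "q * (\<epsilon> * (1 - (x $ 3 / q)\<^sup>2) / 2) = (\<epsilon> * \<epsilon>) * x $ 2"
    unfolding t by (simp_all add: q_def)
  then show ?thesis
    using q e by (simp add: vec_eq_iff forall_4 axis_def)
qed

context riemannian
begin

text \<open>As \<open>x\<^sub>1 > 0\<close>, one of the signs \<open>\<epsilon> = \<plusminus>1\<close> gives \<open>x\<^sub>1 + \<epsilon> x\<^sub>2 > 0\<close> at the given point.
  The height and the parameter of the parabola are coordinates: if both have zero derivative in a
  direction, the derivative of the position vector in that direction is a multiple of the null vector
  \<open>L\<close>, which positivity of the metric excludes.\<close>

lemma cone_chart_exists:
  assumes cone: "pos M ` points M \<subseteq> cone_cylinder" and p: "p \<in> points M"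
  obtains V \<tau> q L L1 L2 \<epsilon> where "p \<in> V" "cone_chart M V \<tau> q L L1 L2" "\<epsilon>\<^sup>2 = 1"
    "\<And>t. L t = emb4 (parabola \<epsilon> t)" "\<And>t. mink (L2 t) (L2 t) = 0"
proof -
  have xp: "pos M p \<in> cone_cylinder" using cone p by blast
  obtain \<epsilon> :: real where \<epsilon>: "\<epsilon>\<^sup>2 = 1" "pos M p $ 1 + \<epsilon> * pos M p $ 2 > 0"
  proof (cases "pos M p $ 1 + pos M p $ 2 > 0")
    case True
    then show ?thesis using that[of 1] by simp
  next
    case False
    moreover have "pos M p $ 1 > 0" using xp unfolding cone_cylinder_def by blast
    ultimately show ?thesis using that[of "-1"] by simp
  qed
  define N where "N = (\<lambda>x :: real ^ 4. x $ 1 + \<epsilon> * x $ 2)"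
  define S where "S = {x. N x > 0}"
  have smN: "smooth_on T N" if "open T" for T unfolding N_def
    by (intro smooth_on_add smooth_on_mult smooth_on_vec_nth smooth_on_const smooth_on_ident that)
  have S: "open S"
    unfolding S_def N_def by (intro open_Collect_less continuous_intros)
  define W where "W = {r \<in> points M. pos M r \<in> S}"
  have W: "openin (topol M) W" unfolding W_def
    by (rule smooth_map_openin_preimage[OF smooth_pos openin_topspace S])
  have pW: "p \<in> W" using p \<epsilon> unfolding W_def S_def N_def by simp
  have posW: "pos M ` W \<subseteq> S" unfolding W_def by blast
  \<comment> \<open>\<open>N\<close> becomes the factor \<open>q\<close>\<close>
  define G where "G = (\<lambda>r. (pos M r $ 4, pos M r $ 3 / N (pos M r)))"
  have smG: "smooth_map M W G"
    unfolding G_def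
    by (rule smooth_map_comp_pos[OF W S posW, of "\<lambda>x. (x $ 4, x $ 3 / N x)"])
      (intro smooth_on_Pair smooth_on_divide smooth_on_vec_nth smooth_on_ident smN S, simp add: S_def)
  define L where "L = (\<lambda>t. emb4 (parabola \<epsilon> t))"
  define L1 where "L1 = (\<lambda>t. emb4 (vector [t, - \<epsilon> * t, 1]))"
  define L2 where "L2 = (\<lambda>t :: real. emb4 (vector [1, - \<epsilon>, 0]))"
  have curve: "smooth_on UNIV L" "(L has_vector_derivative L1 t) (at t)" "(L1 has_vector_derivative L2 t) (at t)"
    "mink (L t) (L t) = 0" "mink (L1 t) (L1 t) = 1" "mink (L t) d4 = 0" "mink (L2 t) (L2 t) = 0" for t
    unfolding L_def L1_def L2_def by (rule parabola_curve[OF \<epsilon>(1)])+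
  have pos_eq: "pos M r = N (pos M r) *\<^sub>R L (snd (G r)) + fst (G r) *\<^sub>R d4" if "r \<in> W" for r
  proof -
    have "pos M r \<in> cone_cylinder" using cone that unfolding W_def by blast
    from cone_point[OF this \<epsilon>(1)] that show ?thesis
      unfolding W_def S_def N_def L_def G_def by simp
  qed
  obtain c where c: "c \<in> atlas M" "p \<in> fst c" using atlas_covers[OF p] by blast
  interpret C: chart M "fst c" "snd c"
    using atlas_smooth_chart[OF c(1)] by unfold_locales simp
  have "a = 0" if DG: "C.D G p a = 0" for a
  proof (rule ccontr)
    assume "a \<noteq> 0"
    let ?x = "snd c p" and ?T = "snd c ` (fst c \<inter> W)"
    define u where "u = C.rep (\<lambda>r. N (pos M r))"
    have T: "open ?T" "?x \<in> ?T" using C.open_image[OF W] c(2) pW by auto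
    have G: "(C.rep G has_derivative C.D G p) (at ?x)"
      by (rule C.rep_has_derivative[OF smG W c(2) pW])
    have "smooth_map M W (\<lambda>r. N (pos M r))" by (rule smooth_map_comp_pos[OF W S posW smN[OF S]])
    then have u: "(u has_derivative frechet_derivative u (at ?x)) (at ?x)"
      unfolding u_def by (rule C.rep_has_derivative[OF _ W c(2) pW])
    have "((\<lambda>x. u x *\<^sub>R L (snd (C.rep G x)) + fst (C.rep G x) *\<^sub>R d4) has_derivative
        (\<lambda>a. (u ?x *\<^sub>R snd (C.D G p a) *\<^sub>R L1 (snd (C.rep G ?x)) +
          frechet_derivative u (at ?x) a *\<^sub>R L (snd (C.rep G ?x))) + fst (C.D G p a) *\<^sub>R d4)) (at ?x)"
      by (intro has_derivative_add has_derivative_scaleR[OF u]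
          has_derivative_compose[OF has_derivative_snd[OF G] curve(2)[unfolded has_vector_derivative_def]]
          has_derivative_scaleR_left has_derivative_fst[OF G])
    then have "(C.rep (pos M) has_derivative
        (\<lambda>a. (u ?x *\<^sub>R snd (C.D G p a) *\<^sub>R L1 (snd (C.rep G ?x)) +
          frechet_derivative u (at ?x) a *\<^sub>R L (snd (C.rep G ?x))) + fst (C.D G p a) *\<^sub>R d4)) (at ?x)"
    proof (rule has_derivative_transform_within_open[OF _ T])
      show "u x *\<^sub>R L (snd (C.rep G x)) + fst (C.rep G x) *\<^sub>R d4 = C.rep (pos M) x" if "x \<in> ?T" for x
        using that by (elim imageE) (simp add: u_def C.rep_at pos_eq[symmetric])
    qed
    then have "C.D (pos M) p a = frechet_derivative u (at ?x) a *\<^sub>R L (snd (C.rep G ?x))"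
      using DG by (simp add: frechet_derivative_at[symmetric])
    then have "mink (C.D (pos M) p a) (C.D (pos M) p a) = 0"
      by (simp add: mink_simps curve(4))
    then show False using C.metric_positive[OF c(2) \<open>a \<noteq> 0\<close>] by simp
  qed
  then obtain V where V: "openin (topol M) V" "p \<in> V" "V \<subseteq> W" and chV: "smooth_chart M (V, G)"
    using C.smooth_chart_of_map[OF W c(2) pW smG] by blast
  interpret V: chart M V G using chV by unfold_locales
  define q where "q = V.rep (\<lambda>r. N (pos M r))"
  have q: "q (G r) = N (pos M r)" if "r \<in> V" for r
    unfolding q_def by (rule V.rep_at[OF that])
  have "cone_chart M V G q L L1 L2"
  proof
    have "smooth_map M W (\<lambda>r. N (pos M r))" by (rule smooth_map_comp_pos[OF W S posW smN[OF S]])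
    from V.smooth_on_rep[OF this W] V(3) show "smooth_on (G ` V) q"
      unfolding q_def by (simp add: inf_absorb1)
    show "q x \<noteq> 0" if "x \<in> G ` V" for x
      using that V(3) by (elim imageE) (auto simp: q W_def S_def)
    show "pos M r = q (G r) *\<^sub>R L (snd (G r)) + fst (G r) *\<^sub>R d4" if "r \<in> V" for r
      using pos_eq[of r] V(3) that q[OF that] by auto
  qed (rule curve)+
  then show ?thesis
    using that[OF V(2) _ \<epsilon>(1)] curve(7) unfolding L_def by blast
qed

end

section \<open>Pseudo-umbilical surfaces lie in hyperplanes\<close>

lemma has_derivative_slice_z:
  fixes f :: "real \<times> real \<Rightarrow> real"
  assumes "(f has_derivative (\<lambda>a. fst a * A + snd a * B)) (at (z, v))"
  shows "((\<lambda>z. f (z, v)) has_real_derivative A) (at z)"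
proof -
  have "((\<lambda>z. (z, v)) has_derivative (\<lambda>h. (h, 0))) (at z)"
    by (auto intro!: derivative_eq_intros)
  from has_derivative_compose[OF this assms] show ?thesis
    unfolding has_field_derivative_def by (simp add: mult_commute_abs)
qed

lemma has_derivative_slice_v:
  fixes f :: "real \<times> real \<Rightarrow> real"
  assumes "(f has_derivative (\<lambda>a. fst a * A + snd a * B)) (at (z, v))"
  shows "((\<lambda>v. f (z, v)) has_real_derivative B) (at v)"
proof -
  have "((\<lambda>v. (z, v)) has_derivative (\<lambda>h. (0, h))) (at v)"
    by (auto intro!: derivative_eq_intros)
  from has_derivative_compose[OF this assms] show ?thesis
    unfolding has_field_derivative_def by (simp add: mult_commute_abs)
qed

context cone_chart
begin

text \<open>By the first equation \<open>\<rho>\<close> and hence \<open>\<rho>\<^sub>v\<close> do not depend on \<open>z\<close>; by the third, neither does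
  \<open>q\<^sub>z\<^sup>2\<close>, so that \<open>q\<^sub>z\<^sub>z = 0\<close> where \<open>q\<^sub>z \<noteq> 0\<close>. Then \<open>w = 1 / q\<^sub>z\<close> is a function of \<open>v\<close> with
  \<open>w' = - \<rho> / q\<^sub>z\<close>, \<open>w'' = (\<rho>\<^sup>2 + q\<^sub>z\<^sup>2) / (2 q\<^sub>z)\<close> and \<open>w''' = 0\<close>: a quadratic polynomial, whose
  discriminant is \<open>w'\<^sup>2 - 2 w w'' = -1\<close>. The statement is local because constancy is inferred from
  vanishing derivatives on a rectangle.\<close>

lemma umbilical_equations_integrate:
  assumes pde: "\<And>x. x \<in> \<sigma> ` U \<Longrightarrow> dz \<rho> x = 0" "\<And>x. x \<in> \<sigma> ` U \<Longrightarrow> dv (dz q) x = \<rho> x * dz q x"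
      "\<And>x. x \<in> \<sigma> ` U \<Longrightarrow> 2 * dv \<rho> x = (\<rho> x)\<^sup>2 - (dz q x)\<^sup>2"
    and nz: "\<And>x. x \<in> \<sigma> ` U \<Longrightarrow> dz q x \<noteq> 0" and p: "p \<in> U"
  obtains K a0 a1 a2 c where "open K" "\<sigma> p \<in> K" "K \<subseteq> \<sigma> ` U" "a1\<^sup>2 - 4 * a0 * a2 = -1"
    "\<And>x. x \<in> K \<Longrightarrow> 1 / dz q x = a0 + a1 * snd x + a2 * (snd x)\<^sup>2"
    "\<And>x. x \<in> K \<Longrightarrow> q x / dz q x = fst x + c"
proof -
  define Q where "Q = dz q"
  obtain z0 v0 where x0: "\<sigma> p = (z0, v0)" by (cases "\<sigma> p")
  have "(z0, v0) \<in> \<sigma> ` U" using p x0 by (metis imageI)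
  then obtain A B where AB: "open A" "open B" "z0 \<in> A" "v0 \<in> B" "A \<times> B \<subseteq> \<sigma> ` U"
    using open_image_U unfolding open_prod_def by (auto 0 4)
  obtain e1 where e1: "e1 > 0" "ball z0 e1 \<subseteq> A" using AB(1,3) open_contains_ball by blast
  obtain e2 where e2: "e2 > 0" "ball v0 e2 \<subseteq> B" using AB(2,4) open_contains_ball by blast
  define I J where "I = ball z0 e1" and "J = ball v0 e2"
  define K where "K = I \<times> J"
  have K: "open K" "convex K" "(z0, v0) \<in> K" "K \<subseteq> \<sigma> ` U"
    unfolding K_def I_def J_def using AB e1 e2 by (auto intro: open_Times convex_Times)
  have IJ: "open I" "convex I" "open J" "z0 \<in> I" unfolding I_def J_def using e1 by auto
  have der: "(f has_derivative (\<lambda>a. fst a * dz f x + snd a * dv f x)) (at x)"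
    if "smooth_on (\<sigma> ` U) f" "x \<in> K" for f :: "real \<times> real \<Rightarrow> real" and x
    using smooth_on_partial_derivative[OF that(1), of x] that(2) K(4) by auto
  have smQ: "smooth_on (\<sigma> ` U) Q" unfolding Q_def by (rule smooth_on_frechet_derivative[OF smooth_q])
  have \<rho>z: "\<rho> (z, v) = \<rho> (z', v)" if "z \<in> I" "z' \<in> I" "v \<in> J" for z z' v
  proof -
    have "((\<lambda>z. \<rho> (z, v)) has_real_derivative 0) (at z within I)" if "z \<in> I" for z
    proof -
      have "(z, v) \<in> K" using that \<open>v \<in> J\<close> unfolding K_def by blast
      moreover from this have "dz \<rho> (z, v) = 0" using pde(1) K(4) by blast
      ultimately have "((\<lambda>z. \<rho> (z, v)) has_real_derivative 0) (at z)"
        using has_derivative_slice_z[OF der[OF smooth_\<rho>]] by metis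
      then show ?thesis by (rule has_field_derivative_at_within)
    qed
    from has_field_derivative_zero_constant[OF IJ(2) this] show ?thesis using that by metis
  qed
  have \<rho>vz: "dv \<rho> (z, v) = dv \<rho> (z', v)" if "z \<in> I" "z' \<in> I" "v \<in> J" for z z' v
  proof -
    have zv: "(z, v) \<in> K" "(z', v) \<in> K" using that unfolding K_def by blast+
    note d = has_derivative_slice_v[OF der[OF smooth_\<rho> zv(1)]] has_derivative_slice_v[OF der[OF smooth_\<rho> zv(2)]]
    have "((\<lambda>v. \<rho> (z', v)) has_real_derivative dv \<rho> (z, v)) (at v)"
      by (rule has_field_derivative_transform_within_open[OF d(1) IJ(3) that(3)]) (rule \<rho>z[OF that(1,2)])
    then show ?thesis by (rule DERIV_unique[OF _ d(2)])
  qed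
  have Qz: "dz Q x = 0" if x: "x \<in> K" for x
  proof -
    obtain z v where zv: "x = (z, v)" "z \<in> I" "v \<in> J" using x unfolding K_def by blast
    have Q2: "(Q (z', v))\<^sup>2 = (Q (z0, v))\<^sup>2" if "z' \<in> I" for z'
    proof -
      have "(z', v) \<in> \<sigma> ` U" "(z0, v) \<in> \<sigma> ` U" using that zv(3) IJ(4) K(4) unfolding K_def by blast+
      from pde(3)[OF this(1)] pde(3)[OF this(2)] show ?thesis
        using \<rho>z[OF that IJ(4) zv(3)] \<rho>vz[OF that IJ(4) zv(3)] unfolding Q_def by simp
    qed
    have "((\<lambda>z. Q (z, v)) has_real_derivative dz Q (z, v)) (at z)"
      using has_derivative_slice_z[OF der[OF smQ]] x unfolding zv(1) by blast
    from DERIV_power[OF this, of 2]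
    have "((\<lambda>z. (Q (z, v))\<^sup>2) has_real_derivative 2 * dz Q (z, v) * Q (z, v)) (at z)"
      by (simp add: mult.assoc)
    moreover have "((\<lambda>z. (Q (z, v))\<^sup>2) has_real_derivative 0) (at z)"
      by (rule has_field_derivative_transform_within_open[OF DERIV_const IJ(1) zv(2)]) (rule Q2[symmetric])
    ultimately have "2 * dz Q (z, v) * Q (z, v) = 0" by (rule DERIV_unique)
    moreover have "Q x \<noteq> 0" using nz x K(4) unfolding Q_def by blast
    ultimately show ?thesis unfolding zv(1) by simp
  qed
  have nzK: "Q x \<noteq> 0" "q x \<noteq> 0" if "x \<in> K" for x using that nz q_nonzero K(4) unfolding Q_def by blast+
  have dQ: "(Q has_derivative (\<lambda>a. snd a * (\<rho> x * Q x))) (at x)" if x: "x \<in> K" for x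
    using der[OF smQ x] Qz[OF x] pde(2)[of x] K(4) x unfolding Q_def by auto
  have d\<rho>: "(\<rho> has_derivative (\<lambda>a. snd a * (((\<rho> x)\<^sup>2 - (Q x)\<^sup>2) / 2))) (at x)" if x: "x \<in> K" for x
  proof -
    have "x \<in> \<sigma> ` U" using x K(4) by blast
    from pde(3)[OF this] have v: "dv \<rho> x = ((\<rho> x)\<^sup>2 - (Q x)\<^sup>2) / 2" unfolding Q_def by simp
    show ?thesis
      using der[OF smooth_\<rho> x] unfolding v pde(1)[OF \<open>x \<in> \<sigma> ` U\<close>] by simp
  qed
  have dq: "(q has_derivative (\<lambda>a. fst a * Q x + snd a * (\<rho> x * q x))) (at x)" if x: "x \<in> K" for x
  proof -
    have "dv q x = \<rho> x * q x" unfolding \<rho>_def using nzK(2)[OF x] by simp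
    then show ?thesis using der[OF smooth_q x] unfolding Q_def by simp
  qed
  define w0 w1 w2 where "w0 = (\<lambda>x. 1 / Q x)" and "w1 = (\<lambda>x. - \<rho> x / Q x)"
    and "w2 = (\<lambda>x. ((\<rho> x)\<^sup>2 + (Q x)\<^sup>2) / (2 * Q x))"
  have dw0: "(w0 has_derivative (\<lambda>a. snd a * w1 x)) (at x)" if x: "x \<in> K" for x
    unfolding w0_def w1_def using nzK(1)[OF x]
    by (auto intro!: derivative_eq_intros dQ[OF x] simp: fun_eq_iff field_simps power2_eq_square)
  have dw1: "(w1 has_derivative (\<lambda>a. snd a * w2 x)) (at x)" if x: "x \<in> K" for x
    unfolding w1_def w2_def using nzK(1)[OF x]
    by (auto intro!: derivative_eq_intros dQ[OF x] d\<rho>[OF x] simp: fun_eq_iff field_simps power2_eq_square)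
  have dw2: "(w2 has_derivative (\<lambda>a. 0)) (at x)" if x: "x \<in> K" for x
    unfolding w2_def using nzK(1)[OF x]
    by (auto intro!: derivative_eq_intros dQ[OF x] d\<rho>[OF x] simp: fun_eq_iff field_simps power2_eq_square)
  have const: "\<exists>c. \<forall>x\<in>K. f x = c" if "\<And>x. x \<in> K \<Longrightarrow> (f has_derivative (\<lambda>a. 0)) (at x)"
    for f :: "real \<times> real \<Rightarrow> real"
    by (rule has_derivative_zero_constant[OF K(2)]) (rule has_derivative_at_withinI[OF that])
  obtain b2 where b2: "\<And>x. x \<in> K \<Longrightarrow> w2 x = b2" using const[of w2] dw2 by blast
  \<comment> \<open>the Taylor coefficients of \<open>w0\<close> at \<open>v = 0\<close>, expressed at an arbitrary point\<close>
  obtain a1 where a1: "\<And>x. x \<in> K \<Longrightarrow> w1 x - snd x * w2 x = a1"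
  proof -
    have "((\<lambda>x. w1 x - snd x * w2 x) has_derivative (\<lambda>a. 0)) (at x)" if x: "x \<in> K" for x
      by (auto intro!: derivative_eq_intros dw1[OF x] dw2[OF x] simp: fun_eq_iff)
    from const[OF this] that show ?thesis by blast
  qed
  obtain a0 where a0: "\<And>x. x \<in> K \<Longrightarrow> w0 x - snd x * w1 x + snd x * snd x * w2 x / 2 = a0"
  proof -
    have "((\<lambda>x. w0 x - snd x * w1 x + snd x * snd x * w2 x / 2) has_derivative (\<lambda>a. 0)) (at x)" if x: "x \<in> K" for x
      by (auto intro!: derivative_eq_intros dw0[OF x] dw1[OF x] dw2[OF x] simp: fun_eq_iff field_simps)
    from const[OF this] that show ?thesis by blast
  qed
  obtain c where c: "\<And>x. x \<in> K \<Longrightarrow> q x / Q x - fst x = c"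
  proof -
    have "((\<lambda>x. q x / Q x - fst x) has_derivative (\<lambda>a. 0)) (at x)" if x: "x \<in> K" for x
      using nzK(1)[OF x]
      by (auto intro!: derivative_eq_intros dq[OF x] dQ[OF x] simp: fun_eq_iff field_simps power2_eq_square)
    from const[OF this] that show ?thesis by blast
  qed
  show ?thesis
  proof
    show "open K" "\<sigma> p \<in> K" "K \<subseteq> \<sigma> ` U" using K x0 by auto
    show "1 / dz q x = a0 + a1 * snd x + b2 / 2 * (snd x)\<^sup>2" if x: "x \<in> K" for x
      using a0[OF x] a1[OF x] b2[OF x] unfolding w0_def Q_def by (simp add: field_simps power2_eq_square)
    show "q x / dz q x = fst x + c" if "x \<in> K" for x using c[OF that] unfolding Q_def by simp
    let ?x = "\<sigma> p"
    have x: "?x \<in> K" using K x0 by simp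
    have "a1\<^sup>2 - 4 * a0 * (b2 / 2) = (w1 ?x)\<^sup>2 - 2 * w0 ?x * w2 ?x"
      unfolding a0[OF x, symmetric] a1[OF x, symmetric] b2[OF x, symmetric]
      by (simp add: field_simps power2_eq_square)
    also have "\<dots> = -1"
      unfolding w0_def w1_def w2_def using nzK(1)[OF x] by (simp add: field_simps power2_eq_square)
    finally show "a1\<^sup>2 - 4 * a0 * (b2 / 2) = -1" .
  qed
qed

end

lemma cos_sin_arctan_divide:
  assumes "c > 0" "c\<^sup>2 + s\<^sup>2 = 1"
  shows "cos (arctan (s / c)) = c" "sin (arctan (s / c)) = s"
proof -
  have "1 + (s / c)\<^sup>2 = (1 / c)\<^sup>2"
    using assms by (simp add: field_simps)
  then have "sqrt (1 + (s / c)\<^sup>2) = 1 / c" using assms(1) by simp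
  then show "cos (arctan (s / c)) = c" "sin (arctan (s / c)) = s"
    using assms(1) by (simp_all add: cos_arctan sin_arctan)
qed

context riemannian
begin

text \<open>Every quadratic polynomial in \<open>v\<close> is \<open>\<langle>W, L(v)\<rangle>\<close> for a unique vector \<open>W\<close> of the hyperplane
  \<open>x\<^sub>4 = 0\<close>, and its discriminant is \<open>\<langle>W, W\<rangle>\<close>. Thus \<open>1 / q\<^sub>z = \<langle>W, L\<rangle>\<close> with \<open>W\<close> a unit
  timelike vector, and multiplication by \<open>q\<close> gives \<open>\<langle>W, \<phi>\<rangle> = q / q\<^sub>z = x\<^sub>4 + c\<close>.\<close>

lemma pseudo_umbilical_hyperplane:
  assumes cone: "pos M ` points M \<subseteq> cone_cylinder" and alpha: "\<forall>p \<in> points M. alpha M p \<noteq> 0"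
    and pu: "pseudo_umbilical M" and p: "p \<in> points M"
  obtains U W c where "openin (topol M) U" "p \<in> U" "mink W W = -1"
    "\<And>r. r \<in> U \<Longrightarrow> mink W (proj3 (pos M r)) = pos M r $ 4 + c"
    "\<And>r. r \<in> U \<Longrightarrow> pos M r $ 4 + c \<noteq> 0"
proof -
  obtain V \<tau> q L L1 L2 \<epsilon> where V: "p \<in> V" "cone_chart M V \<tau> q L L1 L2" and \<epsilon>: "\<epsilon>\<^sup>2 = 1"
    and L: "\<And>t. L t = emb4 (parabola \<epsilon> t)" and L2: "\<And>t. mink (L2 t) (L2 t) = 0"
    by (rule cone_chart_exists[OF cone p]) (rule that)
  interpret cone_chart M V \<tau> q L L1 L2 by (rule V(2))
  obtain f where f: "\<And>r. r \<in> points M \<Longrightarrow> \<forall>v \<in> tangent_space M r. \<forall>w \<in> tangent_space M r.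
      mink (shape_op M (mean_curv M) r v) w = f r * mink v w"
    using pu unfolding pseudo_umbilical_def by blast
  have pde: "dz \<rho> x = 0" "dv (dz q) x = \<rho> x * dz q x" "2 * dv \<rho> x = (\<rho> x)\<^sup>2 - (dz q x)\<^sup>2"
    and nz: "dz q x \<noteq> 0" if x: "x \<in> \<tau> ` V" for x
  proof -
    obtain r where r: "r \<in> V" "x = \<tau> r" using x by blast
    show "dz \<rho> x = 0" "dv (dz q) x = \<rho> x * dz q x" "2 * dv \<rho> x = (\<rho> x)\<^sup>2 - (dz q x)\<^sup>2"
      using f[OF U_points[OF r(1)]] unfolding pseudo_umbilical_at_iff[OF r(1)] r(2) L2 by simp_all
    show "dz q x \<noteq> 0"
      using alpha U_points[OF r(1)] alpha_cone[OF r(1)] r(2) by force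
  qed
  obtain K a0 a1 a2 c where K: "open K" "\<tau> p \<in> K" "K \<subseteq> \<tau> ` V" and a: "a1\<^sup>2 - 4 * a0 * a2 = -1"
    and w: "\<And>x. x \<in> K \<Longrightarrow> 1 / dz q x = a0 + a1 * snd x + a2 * (snd x)\<^sup>2"
    and c: "\<And>x. x \<in> K \<Longrightarrow> q x / dz q x = fst x + c"
    by (rule umbilical_equations_integrate[OF pde nz V(1)]) (assumption | rule that)+
  define W :: "real ^ 3" where "W = vector [- (a0 + a2), \<epsilon> * (a0 - a2), a1]"
  have e: "\<epsilon> * \<epsilon> = 1" using \<epsilon> by (simp add: power2_eq_square)
  then have e': "\<epsilon> * (\<epsilon> * b) = b" for b by (metis mult.assoc mult_1)
  have Wp: "mink W (parabola \<epsilon> t) = a0 + a1 * t + a2 * t\<^sup>2" for t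
    unfolding W_def mink_3 by (simp add: field_simps e')
  show ?thesis
  proof
    show "openin (topol M) (V \<inter> \<tau> -` K)" by (rule openin_preimage[OF K(1)])
    show "p \<in> V \<inter> \<tau> -` K" using V K by blast
    show "mink W W = -1"
      using a unfolding W_def mink_3 by (simp add: algebra_simps e' power2_eq_square)
    fix r assume "r \<in> V \<inter> \<tau> -` K"
    then have r: "r \<in> V" "\<tau> r \<in> K" by blast+
    have x: "\<tau> r \<in> \<tau> ` V" using r(1) by blast
    have pr: "pos M r = emb4 (q (\<tau> r) *\<^sub>R parabola \<epsilon> (snd (\<tau> r))) + fst (\<tau> r) *\<^sub>R d4"
      using pos_eq[OF r(1)] by (simp add: L linear_scale[OF linear_emb4])
    then have z: "pos M r $ 4 = fst (\<tau> r)" by (simp add: axis_def)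
    have "mink W (proj3 (pos M r)) = q (\<tau> r) * (1 / dz q (\<tau> r))"
      unfolding pr proj3_emb4 w[OF r(2)] Wp[symmetric] by (simp add: mink_simps)
    then show "mink W (proj3 (pos M r)) = pos M r $ 4 + c"
      using c[OF r(2)] z by simp
    show "pos M r $ 4 + c \<noteq> 0"
      using c[OF r(2)] z q_nonzero[OF x] nz[OF x] by (metis divide_eq_0_iff)
  qed
qed

text \<open>Divided by \<open>k = x\<^sub>4 + c\<close>, the first three components of the position vector run through the
  circle of null vectors \<open>y\<close> with \<open>\<langle>W, y\<rangle> = 1\<close>. An isometry maps the circle of the model to it,
  and can be chosen to send \<open>t = 0\<close> to the given point, which makes the angle an arc tangent near
  that point. No time orientation is fixed: \<open>k\<close>, and with it \<open>y\<^sub>1\<close>, may be negative.\<close>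

lemma congruent_to_model_if_hyperplane:
  assumes cone: "pos M ` points M \<subseteq> cone_cylinder" and U: "openin (topol M) U" "p \<in> U"
    and WW: "mink W W = -1" and hyp: "\<And>r. r \<in> U \<Longrightarrow> mink W (proj3 (pos M r)) = pos M r $ 4 + c"
    and nz: "\<And>r. r \<in> U \<Longrightarrow> pos M r $ 4 + c \<noteq> 0"
  shows "\<exists>V. openin (topol M) V \<and> p \<in> V \<and> congruent_to M V (model c)"
proof -
  define k where "k r = pos M r $ 4 + c" for r
  define y where "y r = (1 / k r) *\<^sub>R proj3 (pos M r)" for r
  have k: "k r \<noteq> 0" "proj3 (pos M r) = k r *\<^sub>R y r" "mink W (y r) = 1" "mink (y r) (y r) = 0"
    if r: "r \<in> U" for r
  proof -
    show k0: "k r \<noteq> 0" unfolding k_def by (rule nz[OF r])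
    then show "proj3 (pos M r) = k r *\<^sub>R y r" unfolding y_def by simp
    show "mink W (y r) = 1" using k0 hyp[OF r] unfolding y_def k_def by (simp add: mink_simps)
    have "pos M r \<in> cone_cylinder" using cone r openin_subset[OF U(1)] by blast
    then have "mink (proj3 (pos M r)) (proj3 (pos M r)) = 0"
      unfolding cone_cylinder_def mink_3 by (simp add: power2_eq_square)
    then show "mink (y r) (y r) = 0" unfolding y_def by (simp add: mink_simps)
  qed
  define X where "X = W + y p"
  define Y where "Y = lorentz_cross W X"
  have X: "mink X X = 1" "mink W X = 0"
    unfolding X_def using k[OF U(2)] WW by (simp_all add: mink_simps mink_commute[of "y p" W])
  note Y = lorentz_frame[OF WW X, folded Y_def]
  have frame: "y r = mink (y r) X *\<^sub>R X + mink (y r) Y *\<^sub>R Y - W" if "r \<in> U" for r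
  proof -
    have "y r = - mink (y r) W *\<^sub>R W + mink (y r) X *\<^sub>R X + mink (y r) Y *\<^sub>R Y" by (rule Y(4))
    also have "\<dots> = mink (y r) X *\<^sub>R X + mink (y r) Y *\<^sub>R Y - W"
      using k(3)[OF that] by (simp add: mink_commute[of "y r" W])
    finally show ?thesis .
  qed
  have circle: "(mink (y r) X)\<^sup>2 + (mink (y r) Y)\<^sup>2 = 1" if "r \<in> U" for r
  proof -
    have "0 = mink (y r) (mink (y r) X *\<^sub>R X + mink (y r) Y *\<^sub>R Y - W)"
      by (simp only: frame[OF that, symmetric] k(4)[OF that])
    also have "\<dots> = (mink (y r) X)\<^sup>2 + (mink (y r) Y)\<^sup>2 - 1"
      using k(3)[OF that] by (simp add: mink_simps power2_eq_square mink_commute[of "y r" W])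
    finally show ?thesis by simp
  qed
  \<comment> \<open>the half of the circle where the cosine \<open>\<langle>y, X\<rangle>\<close> is positive\<close>
  define S where "S = {x :: real ^ 4. (x $ 4 + c) * mink (proj3 x) X > 0}"
  have S: "open S" unfolding S_def mink_3 proj3_nth by (intro open_Collect_less continuous_intros)
  define V0 where "V0 = {r \<in> U. pos M r \<in> S}"
  have "smooth_map M U (pos M)"
    using smooth_map_comp_pos[OF U(1) open_UNIV _ smooth_on_ident[OF open_UNIV]] by simp
  from smooth_map_openin_preimage[OF this U(1) S]
  have V0: "openin (topol M) V0" unfolding V0_def .
  have V0U: "V0 \<subseteq> U" and posV0: "pos M ` V0 \<subseteq> S" unfolding V0_def by auto
  have "mink (y p) X = 1"
    unfolding X_def using k(3,4)[OF U(2)] by (simp add: mink_simps mink_commute[of "y p" W])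
  then have "mink (proj3 (pos M p)) X = k p" by (simp add: k(2)[OF U(2)] mink_simps)
  then have "(pos M p $ 4 + c) * mink (proj3 (pos M p)) X = k p * k p" unfolding k_def by simp
  moreover have "k p * k p > 0" using k(1)[OF U(2)] not_real_square_gt_zero[of "k p"] by blast
  ultimately have pV0: "p \<in> V0" using U(2) unfolding V0_def S_def by simp
  define T where "T = (\<lambda>x. arctan (mink (proj3 x) Y / mink (proj3 x) X))"
  define G where "G r = (pos M r $ 4, T (pos M r))" for r
  have smT: "smooth_on S (\<lambda>x. (x $ 4, T x))"
  proof -
    have "smooth_on S (\<lambda>x. mink (proj3 x) Y / mink (proj3 x) X)"
      by (intro smooth_on_divide smooth_on_mink smooth_on_bounded_linear bounded_linear_proj3 smooth_on_const S)
        (auto simp: S_def)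
    from smooth_on_compose[OF smooth_on_arctan this S open_UNIV] show ?thesis
      unfolding T_def by (intro smooth_on_Pair smooth_on_vec_nth smooth_on_ident S) auto
  qed
  have smG: "smooth_map M V0 G"
    unfolding G_def by (rule smooth_map_comp_pos[OF V0 S posV0 smT])
  define R where "R = (\<lambda>x. - mink x W\<^sub>0 *\<^sub>R W + mink x X\<^sub>0 *\<^sub>R X + mink x Y\<^sub>0 *\<^sub>R Y)"
  have R: "linear R" "mink (R u) (R v) = mink u v" "R (model_circle t) = cos t *\<^sub>R X + sin t *\<^sub>R Y - W" for u v t
    unfolding R_def by (rule frame_isometry[OF WW X Y(1-3)])+
  define L where "L t = emb4 (R (model_circle t))" for t
  define Q where "Q x = emb4 (R (proj3 x)) + x $ 4 *\<^sub>R d4" for x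
  have Q: "hyperplane_isometry Q" unfolding Q_def by (rule hyperplane_isometryI[OF R(1,2)])
  have Q_model: "Q (model c x) = (fst x + c) *\<^sub>R L (snd x) + fst x *\<^sub>R d4" for x
    unfolding Q_def model_eq proj3_emb4 L_def
    by (simp add: linear_scale[OF R(1)] linear_scale[OF linear_emb4] axis_def)
  have pos_eq: "pos M r = Q (model c (G r))" if r: "r \<in> V0" for r
  proof -
    have rU: "r \<in> U" using r V0U by blast
    have "k r * mink (proj3 (pos M r)) X > 0" using r unfolding V0_def S_def k_def by simp
    then have "(k r * k r) * mink (y r) X > 0" by (simp add: k(2)[OF rU] mink_simps)
    moreover have "k r * k r > 0" using k(1)[OF rU] not_real_square_gt_zero[of "k r"] by blast
    ultimately have pos: "mink (y r) X > 0" by (rule zero_less_mult_pos)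
    have "mink (proj3 (pos M r)) Y / mink (proj3 (pos M r)) X = mink (y r) Y / mink (y r) X"
      using k(1)[OF rU] by (simp add: k(2)[OF rU] mink_simps)
    then have cs: "cos (snd (G r)) = mink (y r) X" "sin (snd (G r)) = mink (y r) Y"
      unfolding G_def T_def using cos_sin_arctan_divide[OF pos circle[OF rU]] by simp_all
    have "R (model_circle (snd (G r))) = y r" unfolding R(3) cs by (rule frame[OF rU, symmetric])
    then have "Q (model c (G r)) = emb4 (proj3 (pos M r)) + pos M r $ 4 *\<^sub>R d4"
      unfolding Q_model L_def k(2)[OF rU] by (simp add: G_def k_def linear_scale[OF linear_emb4])
    then show ?thesis by (simp add: emb4_proj3)
  qed
  obtain a where a: "a \<in> atlas M" "p \<in> fst a" using atlas_covers openin_subset[OF U(1)] U(2) by blast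
  interpret C: chart M "fst a" "snd a"
    using atlas_smooth_chart[OF a(1)] by unfold_locales simp
  have "h = 0" if DG: "C.D G p h = 0" for h
  proof (rule ccontr)
    assume "h \<noteq> 0"
    let ?x = "snd a p" and ?T = "snd a ` (fst a \<inter> V0)"
    have T: "open ?T" "?x \<in> ?T" using C.open_image[OF V0] a(2) pV0 by auto
    have G: "(C.rep G has_derivative C.D G p) (at ?x)"
      by (rule C.rep_has_derivative[OF smG V0 a(2) pV0])
    define L' where "L' t = emb4 (R (cos t *\<^sub>R Y\<^sub>0 - sin t *\<^sub>R X\<^sub>0))" for t
    have L': "(L has_vector_derivative L' t) (at t)" for t
      using model_isometry_circle(2)[OF R(1)] unfolding L_def L'_def .
    have "((\<lambda>x. (fst (C.rep G x) + c) *\<^sub>R L (snd (C.rep G x)) + fst (C.rep G x) *\<^sub>R d4) has_derivative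
        (\<lambda>h. ((fst (C.rep G ?x) + c) *\<^sub>R snd (C.D G p h) *\<^sub>R L' (snd (C.rep G ?x)) +
          (fst (C.D G p h) + 0) *\<^sub>R L (snd (C.rep G ?x))) + fst (C.D G p h) *\<^sub>R d4)) (at ?x)"
      by (intro has_derivative_add has_derivative_scaleR has_derivative_const
          has_derivative_compose[OF has_derivative_snd[OF G] L'[unfolded has_vector_derivative_def]]
          has_derivative_scaleR_left has_derivative_fst[OF G])
    then have "(C.rep (pos M) has_derivative
        (\<lambda>h. ((fst (C.rep G ?x) + c) *\<^sub>R snd (C.D G p h) *\<^sub>R L' (snd (C.rep G ?x)) +
          (fst (C.D G p h) + 0) *\<^sub>R L (snd (C.rep G ?x))) + fst (C.D G p h) *\<^sub>R d4)) (at ?x)"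
    proof (rule has_derivative_transform_within_open[OF _ T])
      show "(fst (C.rep G x) + c) *\<^sub>R L (snd (C.rep G x)) + fst (C.rep G x) *\<^sub>R d4 = C.rep (pos M) x"
        if "x \<in> ?T" for x
        using that by (elim imageE) (simp add: C.rep_at pos_eq Q_model)
    qed
    then have "C.D (pos M) p h = 0" using DG by (simp add: frechet_derivative_at[symmetric])
    then show False using C.metric_positive[OF a(2) \<open>h \<noteq> 0\<close>] by (simp add: mink_simps)
  qed
  then obtain V where V: "openin (topol M) V" "p \<in> V" "V \<subseteq> V0" "smooth_chart M (V, G)"
    by (rule C.smooth_chart_of_map[OF V0 a(2) pV0 smG]) (assumption | rule that)+
  have "\<forall>r\<in>V. pos M r = Q (model c (G r))" using pos_eq V(3) by blast
  with V(4) Q have "congruent_to M V (model c)"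
    unfolding congruent_to_def by (intro exI[of _ Q] exI[of _ G] conjI)
  with V(1,2) show ?thesis by (intro exI[of _ V] conjI)
qed

end

section \<open>The classification\<close>

theorem theorem5p7:
  fixes M :: "'a surface"
  assumes "riemannian_surface M"
    and "pos M ` points M \<subseteq> cone_cylinder"
    and "\<forall>p \<in> points M. alpha M p \<noteq> 0"
  shows "pseudo_umbilical M \<longleftrightarrow>
    (\<forall>p \<in> points M. \<exists>U. openin (topol M) U \<and> p \<in> U \<and> (\<exists>c\<^sub>1. congruent_to M U (model c\<^sub>1)))"
proof -
  interpret riemannian M using assms(1) by unfold_locales
  show ?thesis
  proof
    assume pu: "pseudo_umbilical M"
    show "\<forall>p \<in> points M. \<exists>U. openin (topol M) U \<and> p \<in> U \<and> (\<exists>c\<^sub>1. congruent_to M U (model c\<^sub>1))"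
    proof
      fix p assume p: "p \<in> points M"
      obtain U W c where "openin (topol M) U" "p \<in> U" "mink W W = -1"
        "\<And>r. r \<in> U \<Longrightarrow> mink W (proj3 (pos M r)) = pos M r $ 4 + c"
        "\<And>r. r \<in> U \<Longrightarrow> pos M r $ 4 + c \<noteq> 0"
        by (rule pseudo_umbilical_hyperplane[OF assms(2,3) pu p]) (rule that)
      from congruent_to_model_if_hyperplane[OF assms(2) this]
      show "\<exists>U. openin (topol M) U \<and> p \<in> U \<and> (\<exists>c\<^sub>1. congruent_to M U (model c\<^sub>1))" by blast
    qed
  next
    assume "\<forall>p \<in> points M. \<exists>U. openin (topol M) U \<and> p \<in> U \<and> (\<exists>c\<^sub>1. congruent_to M U (model c\<^sub>1))"
    then show "pseudo_umbilical M" by (rule pseudo_umbilical_if_model[OF assms(2)])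
  qed
qed

end
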